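(* Let $p\in(0,1)$; let $T=(T_i)_{i\in\mathbb{N}}$ be independent $[0,\infty]$-valued random variables with $T_j$, $j\geq 2$, identically distributed; and let $X=(X_i)_{i\in\mathbb{N}}$ be an i.i.d. sequence of $\{0,1\}$-valued random variables, independent of $T$, with $\mathsf{P}(X_1=1)=p=1-\mathsf{P}(X_1=0)$. Let $S_n:=\sum_{i=1}^n T_i$ for $n\in\mathbb{N}$, let $N_t:=\sum_{n\in\mathbb{N}}\mathbf{1}(S_n\leq t)$ for $t\in[0,\infty)$ be the associated renewal process, and for $i\in\{0,1\}$ let $N^i_t:=\sum_{n\in\mathbb{N}}\mathbf{1}(S_n\leq t,\,X_n=i)$ for $t\in[0,\infty)$ and $R_i:=\inf\{t\in[0,\infty):N^i_t\geq 1\}$ (with $\inf\emptyset=\infty$). (1) Assume that $\mathsf{P}(T_1<\epsilon)>0$ for all $\epsilon>0$, and that either $T_2$ is non-arithmetic or else $\mathsf{P}(T_1=0)=0$. Then $R_0$ and $R_1$ are independent if and only if $N\sim\mathrm{HPP}(\theta)$ for some $\theta\in(0,\infty)$. (2) The same equivalence holds if, instead of the assumptions in (1), $N$ is assumed to be ordinary: $R_0$ and $R_1$ are independent if and only if $N\sim\mathrm{HPP}(\theta)$ for some $\theta\in(0,\infty)$.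
   Context: $\mathbb{N}=\{1,2,\dots\}$ and $\mathbb{N}_0=\mathbb{N}\cup\{0\}$. All random variables are defined on a probability space $(\Omega,\mathcal{F},\mathsf{P})$. Non-arithmetic: $T_2$ is non-arithmetic if there is no $\alpha\in(0,\infty)$ with $\mathsf{P}(T_2\in\{\alpha n:n\in\mathbb{N}_0\cup\{\infty\}\})=1$ (where $\alpha\cdot\infty=\infty$). Ordinary: in general the renewal process $N$ may be delayed ($T_1$ need not have the same law as $T_2$), defective (the $T_i$ can take the value $\infty$) and may have multiple simultaneous arrivals (the $T_i$ can take the value $0$). $N$ is ordinary if it is non-delayed, non-defective and has no multiple simultaneous arrivals, i.e. $T_1$ has the same law as $T_2$, and $\mathsf{P}(0<T_i<\infty)=1$ for all $i\in\mathbb{N}$. Homogeneous Poisson process: for $c\in(0,\infty)$, a process $N=(N_t)_{t\in[0,\infty)}$ is a homogeneous Poisson process of intensity $c$, written $N\sim\mathrm{HPP}(c)$, if it is a counting process (values in $\mathbb{N}_0\cup\{\infty\}$, right-continuous nondecreasing paths) that is finite a.s., has jumps of size $1$ a.s., satisfies $N_0=0$ a.s., and has independent increments with $(N_t-N_s)\mathbf{1}_{\{N_s<\infty\}}\sim\mathrm{Pois}(c(t-s))$ for all $0\leq s\leq t<\infty$, where for $\lambda\in[0,\infty)$, $\mathrm{Pois}(\lambda)$ is the law on $\mathbb{N}_0$ with $\mathrm{Pois}(\lambda)(\{k\})=\lambda^k e^{-\lambda}/k!$. *)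

theory Defs
  imports "HOL-Probability.Probability"
begin

text \<open>Sequences indexed by the positive integers are functions on \<^typ>\<open>nat\<close> of which only
  the values at indices \<open>i \<ge> 1\<close> are used.\<close>

definition arrival_time :: "(nat \<Rightarrow> 'a \<Rightarrow> ennreal) \<Rightarrow> nat \<Rightarrow> 'a \<Rightarrow> ennreal" where
  "arrival_time T n \<omega> = (\<Sum>i=1..n. T i \<omega>)"

text \<open>The series below range over the arrival indices \<open>Suc n \<ge> 1\<close>. In \<^typ>\<open>enat\<close> every
  series converges, possibly to \<open>\<infinity>\<close>.\<close>

definition renewal_process :: "(nat \<Rightarrow> 'a \<Rightarrow> ennreal) \<Rightarrow> real \<Rightarrow> 'a \<Rightarrow> enat" where
  "renewal_process T t \<omega> = (\<Sum>n. of_bool (arrival_time T (Suc n) \<omega> \<le> ennreal t))"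

definition split_process ::
  "(nat \<Rightarrow> 'a \<Rightarrow> ennreal) \<Rightarrow> (nat \<Rightarrow> 'a \<Rightarrow> nat) \<Rightarrow> nat \<Rightarrow> real \<Rightarrow> 'a \<Rightarrow> enat" where
  "split_process T X i t \<omega> =
     (\<Sum>n. of_bool (arrival_time T (Suc n) \<omega> \<le> ennreal t \<and> X (Suc n) \<omega> = i))"

definition first_split_arrival ::
  "(nat \<Rightarrow> 'a \<Rightarrow> ennreal) \<Rightarrow> (nat \<Rightarrow> 'a \<Rightarrow> nat) \<Rightarrow> nat \<Rightarrow> 'a \<Rightarrow> ennreal" where
  "first_split_arrival T X i \<omega> = Inf (ennreal ` {t. 0 \<le> t \<and> split_process T X i t \<omega> \<ge> 1})"

text \<open>Independence of two random elements through the \<open>\<sigma>\<close>-algebras they generate. The library's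
  \<open>indep_var\<close> forces both elements to have the same type.\<close>

definition indep_elements ::
  "'a measure \<Rightarrow> 'b measure \<Rightarrow> ('a \<Rightarrow> 'b) \<Rightarrow> 'c measure \<Rightarrow> ('a \<Rightarrow> 'c) \<Rightarrow> bool" where
  "indep_elements M A f B g \<longleftrightarrow>
     f \<in> measurable M A \<and> g \<in> measurable M B \<and>
     prob_space.indep_set M
       (sets (vimage_algebra (space M) f A)) (sets (vimage_algebra (space M) g B))"

definition non_arithmetic :: "'a measure \<Rightarrow> ('a \<Rightarrow> ennreal) \<Rightarrow> bool" where
  "non_arithmetic M Y \<longleftrightarrow>
     \<not> (\<exists>\<alpha>::real. \<alpha> > 0 \<and>
          measure M {\<omega>\<in>space M. Y \<omega> \<in> insert \<infinity> (range (\<lambda>n::nat. ennreal (\<alpha> * real n)))} = 1)"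

definition ordinary :: "'a measure \<Rightarrow> (nat \<Rightarrow> 'a \<Rightarrow> ennreal) \<Rightarrow> bool" where
  "ordinary M T \<longleftrightarrow>
     distr M borel (T 1) = distr M borel (T 2) \<and>
     (\<forall>i\<ge>1. measure M {\<omega>\<in>space M. 0 < T i \<omega> \<and> T i \<omega> < \<infinity>} = 1)"

text \<open>In contrast to the library's \<^const>\<open>poisson_pmf\<close>, the rate \<open>0\<close> is allowed; since
  \<open>0 ^ 0 = 1\<close>, it gives the point mass at \<open>0\<close>.\<close>

definition Pois :: "real \<Rightarrow> nat measure" where
  "Pois r = density (count_space UNIV) (\<lambda>k. ennreal (r ^ k * exp (- r) / fact k))"

text \<open>Processes are indexed by \<open>[0, \<infinity>)\<close>; the values at negative times are irrelevant.\<close>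

definition counting_process :: "'a measure \<Rightarrow> (real \<Rightarrow> 'a \<Rightarrow> enat) \<Rightarrow> bool" where
  "counting_process M N \<longleftrightarrow>
     (\<forall>t\<ge>0. N t \<in> measurable M (count_space UNIV)) \<and>
     (\<forall>\<omega>\<in>space M. mono_on {0..} (\<lambda>t. N t \<omega>) \<and> (\<forall>t\<ge>0. continuous (at_right t) (\<lambda>s. N s \<omega>)))"

text \<open>The increment \<open>(N\<^sub>t - N\<^sub>s) 1(N\<^sub>s < \<infinity>)\<close>; the guard is needed since
  \<open>\<infinity> - \<infinity> = \<infinity>\<close> in \<^typ>\<open>enat\<close>.\<close>

definition increment :: "(real \<Rightarrow> 'a \<Rightarrow> enat) \<Rightarrow> real \<Rightarrow> real \<Rightarrow> 'a \<Rightarrow> enat" where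
  "increment N s t \<omega> = (if N s \<omega> < \<infinity> then N t \<omega> - N s \<omega> else 0)"

definition independent_increments :: "'a measure \<Rightarrow> (real \<Rightarrow> 'a \<Rightarrow> enat) \<Rightarrow> bool" where
  "independent_increments M N \<longleftrightarrow>
     (\<forall>(n::nat) u. 0 \<le> u 0 \<and> (\<forall>i<n. u i \<le> u (Suc i)) \<longrightarrow>
        prob_space.indep_vars M (\<lambda>_. count_space UNIV) (\<lambda>i. increment N (u i) (u (Suc i))) {..<n})"

definition HPP :: "'a measure \<Rightarrow> real \<Rightarrow> (real \<Rightarrow> 'a \<Rightarrow> enat) \<Rightarrow> bool" where
  "HPP M c N \<longleftrightarrow>
     counting_process M N \<and>
     (AE \<omega> in M. \<forall>t\<ge>0. N t \<omega> < \<infinity>) \<and>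
     (AE \<omega> in M. \<forall>t>0. let L = Lim (at_left t) (\<lambda>s. N s \<omega>) in N t \<omega> = L \<or> N t \<omega> = L + 1) \<and>
     (AE \<omega> in M. N 0 \<omega> = 0) \<and>
     independent_increments M N \<and>
     (\<forall>s t. 0 \<le> s \<and> s \<le> t \<longrightarrow>
        distr M (count_space UNIV) (increment N s t) =
        distr (Pois (c * (t - s))) (count_space UNIV) enat)"

end

theory Submission
  imports Defs
begin

text \<open>Let \<open>g\<close> and \<open>f\<close> be the Laplace transforms of \<open>T 1\<close> and \<open>T 2\<close>. Splitting according to the first
  index at which the colour changes shows that \<open>R\<^sub>0\<close> and \<open>R\<^sub>1\<close> are independent iff
  \<open>g (a + b) (f a + f b - f a f b) = g a g b\<close> for all \<open>a\<close> and \<open>b\<close>, a condition free of \<open>p\<close>.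
  It suffices to let \<open>a\<close> and \<open>b\<close> range over the natural numbers, since then \<open>f\<close> and \<open>g\<close> list the
  moments of the bounded variables \<open>exp (- T i)\<close>.

  If \<open>f = g\<close>, the equation says that \<open>1 / f - 1\<close> is additive, so both laws are exponential.
  If \<open>T 1\<close> charges every neighbourhood of \<open>0\<close>, letting \<open>b\<close> tend to infinity gives
  \<open>g = F + (1 - F) f\<close> with \<open>F = P (T 2 = 0)\<close>. Either \<open>F = 0\<close> and \<open>f = g\<close>, or \<open>P (T 1 = 0) > 0\<close> and
  the equation can be solved for \<open>f\<close>, which turns out to be a power series in some \<open>r ^ n\<close>, so that
  \<open>T 2\<close> is arithmetic.\<close>

subsection \<open>Arrival times and paths of the renewal process\<close>

text \<open>Why \<open>p\<close> drops out: if the first \<open>n + 1\<close> arrivals have colour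
  \<open>c\<close> and the next one does not, then \<open>R c\<close> is \<open>T 1\<close> while
  \<open>R (1 - c)\<close> is the arrival time of index \<open>n + 2\<close>, a sum that contains
  \<open>T 1\<close> again. This common summand produces \<open>g (a + b)\<close>. Summing over
  \<open>n\<close> gives geometric series, whose denominators \<open>1 - p * f a\<close> and
  \<open>1 - (1 - p) * f b\<close> also appear in the two marginal transforms and cancel. The gaps
  may be infinite. Hence \<open>exp_neg\<close> sends infinity to 0, which makes it an injective map
  into the unit interval that turns sums into products; the convention \<open>0 ^ 0 = 1\<close>
  keeps the moment of order 0 equal to the total mass. The Poisson property is used asymmetrically.
  When it is given, only the laws of the first two arrival times are extracted, and independence
  yields that of \<open>T 2\<close>. When it has to be proved, all joint laws of increments must be
  computed from the exponential gaps.\<close>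

definition exp_neg :: "ennreal \<Rightarrow> real" where
  "exp_neg x = (if x = \<infinity> then 0 else exp (- enn2real x))"

lemma exp_neg_ennreal [simp]: "0 \<le> r \<Longrightarrow> exp_neg (ennreal r) = exp (- r)"
  by (simp add: exp_neg_def)

lemma exp_neg_0 [simp]: "exp_neg 0 = 1"
  by (simp add: exp_neg_def)

lemma exp_neg_top [simp]: "exp_neg top = 0"
  by (simp add: exp_neg_def)

lemma exp_neg_nonneg [simp]: "0 \<le> exp_neg x"
  by (simp add: exp_neg_def)

lemma exp_neg_le_1 [simp]: "exp_neg x \<le> 1"
  by (simp add: exp_neg_def)

lemma exp_neg_add: "exp_neg (x + y) = exp_neg x * exp_neg y"
  by (cases x; cases y) (auto simp: mult_exp_exp ennreal_plus[symmetric] simp del: ennreal_plus)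

lemma exp_neg_sum: "exp_neg (\<Sum>i\<in>A. x i) = (\<Prod>i\<in>A. exp_neg (x i))"
  by (induction A rule: infinite_finite_induct) (auto simp: exp_neg_add)

lemma measurable_exp_neg [measurable]: "exp_neg \<in> borel_measurable borel"
  unfolding exp_neg_def by measurable

text \<open>Because \<open>exp_neg\<close> has a measurable left inverse, it loses no information:
  laws and independence on [0, infinity] can be tested on the unit interval, where moments are
  available.\<close>

lemma borel_ennreal_eq_vimage_exp_neg:
  assumes "A \<in> sets (borel :: ennreal measure)"
  shows "\<exists>B\<in>sets (borel :: real measure). A = exp_neg -` B"
proof -
  \<comment> \<open>Nonpositive arguments go to infinity, the only point where
    \<open>exp_neg\<close> is 0. Arguments above 1 are not values of \<open>exp_neg\<close>; there
    \<open>ennreal\<close> clips to 0.\<close>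
  define h :: "real \<Rightarrow> ennreal" where "h y = (if y \<le> 0 then \<infinity> else ennreal (- ln y))" for y
  have h: "h (exp_neg x) = x" for x
    by (cases x) (auto simp: h_def)
  have [measurable]: "h \<in> borel_measurable borel"
    unfolding h_def by measurable
  have "h -` A \<in> sets borel"
    using measurable_sets[of h borel borel A] assms by simp
  moreover have "A = exp_neg -` (h -` A)"
    by (auto simp: h)
  ultimately show ?thesis by blast
qed

lemma arrival_time_Suc: "arrival_time T (Suc n) \<omega> = arrival_time T n \<omega> + T (Suc n) \<omega>"
  by (simp add: arrival_time_def)

lemma arrival_time_0 [simp]: "arrival_time T 0 \<omega> = 0"
  by (simp add: arrival_time_def)

lemma arrival_time_mono: "m \<le> n \<Longrightarrow> arrival_time T m \<omega> \<le> arrival_time T n \<omega>"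
  unfolding arrival_time_def by (rule sum_mono2) auto

text \<open>Arrival times are nondecreasing in the index, so the counted indices form an initial
  segment and the infinite series reduces to one comparison. The path properties are read off from
  this equivalence.\<close>

lemma enat_le_renewal_process_iff:
  "enat k \<le> renewal_process T t \<omega> \<longleftrightarrow> arrival_time T k \<omega> \<le> ennreal t"
proof (cases k)
  case 0
  then show ?thesis by (simp add: zero_enat_def[symmetric])
next
  case (Suc m)
  let ?f = "\<lambda>n. of_bool (arrival_time T (Suc n) \<omega> \<le> ennreal t) :: enat"
  show ?thesis
  proof
    assume *: "arrival_time T k \<omega> \<le> ennreal t"
    have "enat k = (\<Sum>n<k. 1)"
      by (simp add: of_nat_eq_enat)
    also have "\<dots> = (\<Sum>n<k. ?f n)"
    proof (intro sum.cong refl)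
      fix n assume "n \<in> {..<k}"
      then have "arrival_time T (Suc n) \<omega> \<le> ennreal t"
        using arrival_time_mono[of "Suc n" k T \<omega>] * by (auto intro: order_trans)
      then show "1 = ?f n" by simp
    qed
    also have "\<dots> \<le> suminf ?f"
      by (rule sum_le_suminf) (auto intro: summableI)
    finally show "enat k \<le> renewal_process T t \<omega>"
      by (simp add: renewal_process_def)
  next
    assume *: "enat k \<le> renewal_process T t \<omega>"
    show "arrival_time T k \<omega> \<le> ennreal t"
    proof (rule ccontr)
      assume neg: "\<not> ?thesis"
      have "suminf ?f = (\<Sum>n<m. ?f n)"
      proof (rule suminf_finite)
        fix n assume "n \<notin> {..<m}"
        then have "arrival_time T k \<omega> \<le> arrival_time T (Suc n) \<omega>"
          using Suc by (intro arrival_time_mono) auto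
        then show "?f n = 0" using neg by (auto dest: order_trans)
      qed auto
      also have "\<dots> \<le> (\<Sum>n<m. 1)"
        by (rule sum_mono) auto
      also have "\<dots> = enat m" by (simp add: of_nat_eq_enat)
      finally have "renewal_process T t \<omega> \<le> enat m"
        by (simp add: renewal_process_def)
      with * have "enat k \<le> enat m" by (rule order_trans)
      then show False using Suc by simp
    qed
  qed
qed

lemma renewal_process_eq_enat_iff:
  "renewal_process T t \<omega> = enat k \<longleftrightarrow>
     arrival_time T k \<omega> \<le> ennreal t \<and> ennreal t < arrival_time T (Suc k) \<omega>"
proof -
  have "N = enat k \<longleftrightarrow> enat k \<le> N \<and> \<not> enat (Suc k) \<le> N" for N :: enat
    by (cases N) auto
  then show ?thesis
    by (metis enat_le_renewal_process_iff not_le)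
qed

lemma renewal_process_mono:
  assumes "s \<le> t" shows "renewal_process T s \<omega> \<le> renewal_process T t \<omega>"
proof (cases "renewal_process T s \<omega>")
  case (enat k)
  then have "arrival_time T k \<omega> \<le> ennreal s"
    by (simp add: renewal_process_eq_enat_iff)
  also have "\<dots> \<le> ennreal t" using assms by (rule ennreal_leI)
  finally show ?thesis
    unfolding enat by (simp add: enat_le_renewal_process_iff)
next
  case infinity
  have "enat k \<le> renewal_process T t \<omega>" for k
  proof -
    have "arrival_time T k \<omega> \<le> ennreal s"
      using infinity by (simp flip: enat_le_renewal_process_iff)
    also have "\<dots> \<le> ennreal t" using assms by (rule ennreal_leI)
    finally show ?thesis by (simp add: enat_le_renewal_process_iff)
  qed
  then show ?thesis by (cases "renewal_process T t \<omega>") (auto, metis Suc_n_not_le_n)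
qed

text \<open>The path is even constant just to the right of \<open>t\<close>: at a finite level
  \<open>k\<close> the arrival of index \<open>k + 1\<close> comes strictly after \<open>t\<close>,
  and at level infinity monotonicity leaves no room.\<close>

lemma renewal_process_right_continuous:
  assumes "0 \<le> t"
  shows "continuous (at_right t) (\<lambda>s. renewal_process T s \<omega>)"
proof -
  have "eventually (\<lambda>s. renewal_process T s \<omega> = renewal_process T t \<omega>) (at_right t)"
  proof (cases "renewal_process T t \<omega>")
    case (enat k)
    then have k: "arrival_time T k \<omega> \<le> ennreal t" "ennreal t < arrival_time T (Suc k) \<omega>"
      by (simp_all add: renewal_process_eq_enat_iff)
    obtain b where b: "t < b" "ennreal b \<le> arrival_time T (Suc k) \<omega>"
    proof (cases "arrival_time T (Suc k) \<omega>")
      case (real r)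
      with k assms show ?thesis by (intro that[of r]) (auto simp: ennreal_less_iff)
    next
      case top
      then show ?thesis by (intro that[of "t + 1"]) auto
    qed
    have "eventually (\<lambda>s. s \<in> {t<..<b}) (at_right t)"
      using b by (intro eventually_at_right_real)
    then show ?thesis
    proof eventually_elim
      case (elim s)
      have "ennreal t \<le> ennreal s" using elim by (intro ennreal_leI) auto
      moreover have "ennreal s < ennreal b" using elim assms by (auto simp: ennreal_less_iff)
      ultimately show ?case
        unfolding enat using k b by (auto simp: renewal_process_eq_enat_iff)
    qed
  next
    case infinity
    have "eventually (\<lambda>s. s \<in> {t<..<t+1}) (at_right t)"
      by (intro eventually_at_right_real) auto
    then show ?thesis
    proof eventually_elim
      case (elim s)
      then show ?case using infinity renewal_process_mono[of t s T \<omega>] by auto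
    qed
  qed
  then have "((\<lambda>s. renewal_process T s \<omega>) \<longlongrightarrow> renewal_process T t \<omega>) (at_right t)"
    by (rule tendsto_eventually)
  then show ?thesis
    by (simp add: continuous_within)
qed

text \<open>Strictly positive gaps forbid two arrivals at the same finite time, so just before
  \<open>t\<close> the level is the present one or one less.\<close>

lemma renewal_process_left_jump:
  assumes "0 < t" and fin: "renewal_process T t \<omega> < \<infinity>" and pos: "\<And>i. 0 < i \<Longrightarrow> 0 < T i \<omega>"
  shows "let L = Lim (at_left t) (\<lambda>s. renewal_process T s \<omega>)
         in renewal_process T t \<omega> = L \<or> renewal_process T t \<omega> = L + 1"
proof -
  obtain k where Nk: "renewal_process T t \<omega> = enat k" using fin by auto
  then have k: "arrival_time T k \<omega> \<le> ennreal t" "ennreal t < arrival_time T (Suc k) \<omega>"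
    by (simp_all add: renewal_process_eq_enat_iff)
  have conclude: ?thesis
    if ev: "eventually (\<lambda>s. renewal_process T s \<omega> = enat j) (at_left t)"
      and j: "k = j \<or> k = Suc j" for j
  proof -
    have "Lim (at_left t) (\<lambda>s. renewal_process T s \<omega>) = enat j"
      using tendsto_eventually[OF ev] by (intro tendsto_Lim) auto
    then show ?thesis using j Nk by (auto simp: one_enat_def)
  qed
  \<comment> \<open>Times \<open>s < t\<close> close to \<open>t\<close> lie past the arrival
    \<open>j\<close> and still before the arrival \<open>j + 1\<close>, even when the latter happens
    exactly at \<open>t\<close>.\<close>
  have between: "eventually (\<lambda>s. renewal_process T s \<omega> = enat j) (at_left t)"
    if j: "arrival_time T j \<omega> < ennreal t" "ennreal t \<le> arrival_time T (Suc j) \<omega>" for j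
  proof -
    obtain a where a: "0 \<le> a" "arrival_time T j \<omega> = ennreal a"
      using j by (cases "arrival_time T j \<omega>") auto
    then have "a < t" using j by (auto simp: ennreal_less_iff)
    then have "eventually (\<lambda>s. s \<in> {a<..<t}) (at_left t)"
      by (intro eventually_at_left_real)
    then show ?thesis
    proof eventually_elim
      case (elim s)
      have "ennreal a \<le> ennreal s" using elim by (intro ennreal_leI) auto
      moreover have "ennreal s < ennreal t" using elim a by (auto simp: ennreal_less_iff)
      ultimately show ?case
        using j a by (simp add: renewal_process_eq_enat_iff)
    qed
  qed
  show ?thesis
  proof (cases "arrival_time T k \<omega> < ennreal t")
    case True
    then show ?thesis using between[of k] k by (intro conclude[of k]) auto
  next
    case False
    then have eq: "arrival_time T k \<omega> = ennreal t" using k by auto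
    then have "k \<noteq> 0" using assms by (auto intro!: gr0I)
    then obtain j where j: "k = Suc j" by (cases k) auto
    have fin_j: "arrival_time T j \<omega> < \<infinity>"
      using arrival_time_mono[of j k T \<omega>] eq j by (auto simp: less_top[symmetric] top_unique)
    have "arrival_time T j \<omega> < arrival_time T j \<omega> + T (Suc j) \<omega>"
      using ennreal_add_left_cancel_less[of "arrival_time T j \<omega>" 0 "T (Suc j) \<omega>"] pos[of "Suc j"] fin_j
      by simp
    then have "arrival_time T j \<omega> < ennreal t"
      unfolding eq[symmetric] j arrival_time_Suc .
    then show ?thesis using between[of j] eq j by (intro conclude[of j]) auto
  qed
qed

section \<open>First arrivals of a given colour\<close>

lemma one_le_split_process_iff:
  "1 \<le> split_process T X i t \<omega> \<longleftrightarrow>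
     (\<exists>n. arrival_time T (Suc n) \<omega> \<le> ennreal t \<and> X (Suc n) \<omega> = i)"
proof -
  let ?P = "\<lambda>n. arrival_time T (Suc n) \<omega> \<le> ennreal t \<and> X (Suc n) \<omega> = i"
  have "suminf (\<lambda>n. of_bool (?P n) :: enat) = 0 \<longleftrightarrow> (\<forall>n. \<not> ?P n)"
    by (subst suminf_eq_zero_iff) (auto intro: summableI)
  moreover have "1 \<le> N \<longleftrightarrow> N \<noteq> 0" for N :: enat
    by (cases N) (auto simp: one_enat_def zero_enat_def)
  ultimately show ?thesis
    unfolding split_process_def by simp
qed

text \<open>A countable infimum replaces the one over real times, which yields measurability. An
  arrival at time infinity contributes infinity here and no time at all in the definition, so both
  infima agree.\<close>

lemma first_split_arrival_eq_INF:
  "first_split_arrival T X i \<omega> =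
     (INF n. if X (Suc n) \<omega> = i then arrival_time T (Suc n) \<omega> else \<infinity>)"
proof (rule antisym)
  show "first_split_arrival T X i \<omega> \<le>
     (INF n. if X (Suc n) \<omega> = i then arrival_time T (Suc n) \<omega> else \<infinity>)"
  proof (rule INF_greatest)
    fix n
    show "first_split_arrival T X i \<omega> \<le> (if X (Suc n) \<omega> = i then arrival_time T (Suc n) \<omega> else \<infinity>)"
    proof (cases "X (Suc n) \<omega> = i \<and> arrival_time T (Suc n) \<omega> \<noteq> top")
      case True
      then obtain r where "0 \<le> r" "arrival_time T (Suc n) \<omega> = ennreal r"
        by (cases "arrival_time T (Suc n) \<omega>") auto
      then show ?thesis using True
        unfolding first_split_arrival_def one_le_split_process_iff
        by (auto intro!: Inf_lower image_eqI[of _ _ r] exI[of _ n])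
    qed auto
  qed
next
  show "(INF n. if X (Suc n) \<omega> = i then arrival_time T (Suc n) \<omega> else \<infinity>)
          \<le> first_split_arrival T X i \<omega>"
    unfolding first_split_arrival_def one_le_split_process_iff
  proof (rule Inf_greatest)
    fix x assume "x \<in> ennreal ` {t. 0 \<le> t \<and> (\<exists>n. arrival_time T (Suc n) \<omega> \<le> ennreal t \<and> X (Suc n) \<omega> = i)}"
    then obtain n where "arrival_time T (Suc n) \<omega> \<le> x" "X (Suc n) \<omega> = i" by auto
    then show "(INF n. if X (Suc n) \<omega> = i then arrival_time T (Suc n) \<omega> else \<infinity>) \<le> x"
      by (intro INF_lower2[of n]) auto
  qed
qed

lemma first_split_arrival_eq:
  assumes "X (Suc n) \<omega> = i" "\<And>m. m < n \<Longrightarrow> X (Suc m) \<omega> \<noteq> i"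
  shows "first_split_arrival T X i \<omega> = arrival_time T (Suc n) \<omega>"
  unfolding first_split_arrival_eq_INF
proof (rule antisym)
  show "(INF n. if X (Suc n) \<omega> = i then arrival_time T (Suc n) \<omega> else \<infinity>) \<le> arrival_time T (Suc n) \<omega>"
    using assms by (intro INF_lower2[of n]) auto
  show "arrival_time T (Suc n) \<omega> \<le> (INF n. if X (Suc n) \<omega> = i then arrival_time T (Suc n) \<omega> else \<infinity>)"
  proof (rule INF_greatest)
    fix m show "arrival_time T (Suc n) \<omega> \<le> (if X (Suc m) \<omega> = i then arrival_time T (Suc m) \<omega> else \<infinity>)"
      using assms(2)[of m] arrival_time_mono[of "Suc n" "Suc m" T \<omega>] by (cases "m < n") auto
  qed
qed

subsection \<open>Measures on the unit interval are determined by their moments\<close>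

text \<open>Expand the exponential in the characteristic function and integrate term by term; on the
  unit interval the terms are dominated by the exponential series at the modulus of
  \<open>t\<close>. So the moments determine the characteristic function, and Levy's uniqueness
  theorem applies.\<close>

lemma char_eq_suminf_moments:
  fixes \<mu> :: "real measure"
  assumes "finite_measure \<mu>" and [simp, measurable_cong]: "sets \<mu> = sets borel" and AE: "AE x in \<mu>. x \<in> {0..1}"
  shows "char \<mu> t = (\<Sum>n. ((\<i> * complex_of_real t) ^ n /\<^sub>R fact n) * complex_of_real (\<integral>x. x ^ n \<partial>\<mu>))"
proof -
  interpret finite_measure \<mu> by fact
  let ?f = "\<lambda>n x. (\<i> * complex_of_real (t * x)) ^ n /\<^sub>R fact n"
  have int_pow: "integrable \<mu> (\<lambda>x. x ^ n)" for n
  proof (rule integrable_const_bound[where B=1])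
    show "AE x in \<mu>. norm (x ^ n) \<le> 1"
      using AE by eventually_elim (auto simp: power_le_one)
  qed simp
  have f_eq: "?f n x = ((\<i> * complex_of_real t) ^ n /\<^sub>R fact n) * complex_of_real (x ^ n)" for n x
    by (simp add: power_mult_distrib mult.assoc)
  have int_f: "integrable \<mu> (?f n)" for n
    unfolding f_eq using int_pow[of n] by (intro integrable_mult_right integrable_of_real)
  have norm_f: "norm (?f n x) = \<bar>t * x\<bar> ^ n /\<^sub>R fact n" for n x
    by (simp add: norm_power norm_mult abs_mult)
  have norm_f_le: "AE x in \<mu>. norm (?f n x) \<le> \<bar>t\<bar> ^ n /\<^sub>R fact n" for n
    using AE
  proof eventually_elim
    case (elim x)
    then have "\<bar>t * x\<bar> \<le> \<bar>t\<bar> * 1" unfolding abs_mult by (intro mult_left_mono) auto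
    then have "\<bar>t * x\<bar> ^ n \<le> \<bar>t\<bar> ^ n" by (intro power_mono) auto
    then show ?case unfolding norm_f by (intro scaleR_left_mono) auto
  qed
  have "char \<mu> t = (\<integral>x. (\<Sum>n. ?f n x) \<partial>\<mu>)"
    unfolding char_def exp_def by simp
  also have "\<dots> = (\<Sum>n. \<integral>x. ?f n x \<partial>\<mu>)"
  proof (rule integral_suminf)
    show "AE x in \<mu>. summable (\<lambda>n. norm (?f n x))"
      unfolding norm_f by (intro AE_I2 summable_exp_generic)
    show "summable (\<lambda>n. \<integral>x. norm (?f n x) \<partial>\<mu>)"
    proof (rule summable_comparison_test')
      show "summable (\<lambda>n. measure \<mu> (space \<mu>) * (\<bar>t\<bar> ^ n /\<^sub>R fact n))"
        by (intro summable_mult summable_exp_generic)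
      fix n
      have "(\<integral>x. norm (?f n x) \<partial>\<mu>) \<le> (\<integral>x. \<bar>t\<bar> ^ n /\<^sub>R fact n \<partial>\<mu>)"
        by (rule integral_mono_AE[OF integrable_norm[OF int_f] _ norm_f_le]) simp
      then show "norm (\<integral>x. norm (?f n x) \<partial>\<mu>) \<le> measure \<mu> (space \<mu>) * (\<bar>t\<bar> ^ n /\<^sub>R fact n)"
        by (simp add: integral_nonneg_AE)
    qed
  qed (rule int_f)
  also have "(\<lambda>n. \<integral>x. ?f n x \<partial>\<mu>) =
      (\<lambda>n. ((\<i> * complex_of_real t) ^ n /\<^sub>R fact n) * complex_of_real (\<integral>x. x ^ n \<partial>\<mu>))"
    unfolding f_eq by (subst integral_mult_right_zero, subst integral_complex_of_real) simp
  finally show ?thesis .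
qed

lemma prob_measure_eq_if_moments_eq:
  fixes \<mu> \<nu> :: "real measure"
  assumes "prob_space \<mu>" "sets \<mu> = sets borel" "AE x in \<mu>. x \<in> {0..1}"
    and "prob_space \<nu>" "sets \<nu> = sets borel" "AE x in \<nu>. x \<in> {0..1}"
    and eq: "\<And>n. (\<integral>x. x ^ n \<partial>\<mu>) = (\<integral>x. x ^ n \<partial>\<nu>)"
  shows "\<mu> = \<nu>"
proof (rule Levy_uniqueness)
  show "real_distribution \<mu>" "real_distribution \<nu>"
    using assms by (auto simp: real_distribution_def real_distribution_axioms_def)
  show "char \<mu> = char \<nu>"
    using assms by (intro ext) (simp add: char_eq_suminf_moments prob_space.finite_measure)
qed

text \<open>The moment of order 0 is the total mass, so both measures are normalised by the same
  factor. The extension beyond probability measures serves the weighted laws in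
  \<open>weighted_integral_eq_if_moments_eq\<close>, whose mass is usually below 1.\<close>

lemma finite_measure_eq_if_moments_eq:
  fixes \<mu> \<nu> :: "real measure"
  assumes \<mu>: "finite_measure \<mu>" "sets \<mu> = sets borel" "AE x in \<mu>. x \<in> {0..1}"
    and \<nu>: "finite_measure \<nu>" "sets \<nu> = sets borel" "AE x in \<nu>. x \<in> {0..1}"
    and eq: "\<And>n. (\<integral>x. x ^ n \<partial>\<mu>) = (\<integral>x. x ^ n \<partial>\<nu>)"
  shows "\<mu> = \<nu>"
proof -
  interpret \<mu>: finite_measure \<mu> by fact
  interpret \<nu>: finite_measure \<nu> by fact
  note [simp, measurable_cong] = \<mu>(2) \<nu>(2)
  have sp [simp]: "space \<mu> = UNIV" "space \<nu> = UNIV"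
    using sets_eq_imp_space_eq[OF \<mu>(2)] sets_eq_imp_space_eq[OF \<nu>(2)] by simp_all
  define m where "m = measure \<mu> UNIV"
  have m': "measure \<nu> UNIV = m"
    using eq[of 0] by (simp add: m_def)
  show ?thesis
  proof (cases "m = 0")
    case True
    then have "emeasure \<mu> UNIV = 0" "emeasure \<nu> UNIV = 0"
      using m' by (simp_all add: m_def \<mu>.emeasure_eq_measure \<nu>.emeasure_eq_measure)
    then show ?thesis
      by (intro measure_eqI) (auto intro: order.antisym simp: emeasure_eq_0[of UNIV])
  next
    case False
    then have m: "m > 0" using measure_nonneg[of \<mu> UNIV] by (simp add: m_def less_le)
    have scaled: "emeasure (density \<rho> (\<lambda>_. ennreal (1 / m))) A = ennreal (1 / m) * emeasure \<rho> A"
      if "A \<in> sets \<rho>" for \<rho> :: "real measure" and A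
      using that by (simp add: emeasure_density_const)
    have "density \<mu> (\<lambda>_. ennreal (1 / m)) = density \<nu> (\<lambda>_. ennreal (1 / m))"
    proof (rule prob_measure_eq_if_moments_eq)
      show "prob_space (density \<mu> (\<lambda>_. ennreal (1 / m)))"
        using m by (intro prob_spaceI)
          (simp add: scaled \<mu>.emeasure_eq_measure m_def[symmetric] ennreal_mult[symmetric])
      show "prob_space (density \<nu> (\<lambda>_. ennreal (1 / m)))"
        using m m' by (intro prob_spaceI)
          (simp add: scaled \<nu>.emeasure_eq_measure ennreal_mult[symmetric])
      show "AE x in density \<mu> (\<lambda>_. ennreal (1 / m)). x \<in> {0..1}"
           "AE x in density \<nu> (\<lambda>_. ennreal (1 / m)). x \<in> {0..1}"
        using \<mu>(3) \<nu>(3) by (auto simp: AE_density elim: eventually_mono)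
      show "(\<integral>x. x ^ n \<partial>density \<mu> (\<lambda>_. ennreal (1 / m))) = (\<integral>x. x ^ n \<partial>density \<nu> (\<lambda>_. ennreal (1 / m)))" for n
        using m eq[of n] by (simp add: integral_density)
    qed auto
    then have *: "ennreal (1 / m) * emeasure \<mu> A = ennreal (1 / m) * emeasure \<nu> A" if "A \<in> sets borel" for A
      using that scaled[of A \<mu>] scaled[of A \<nu>] by simp
    show ?thesis
    proof (rule measure_eqI)
      fix A assume "A \<in> sets \<mu>"
      then have "A \<in> sets borel" by simp
      from *[OF this] show "emeasure \<mu> A = emeasure \<nu> A"
        using m by (subst (asm) ennreal_mult_cancel_left) auto
    qed simp
  qed
qed

section \<open>Independence from the factorisation of mixed moments\<close>

context prob_space
begin

text \<open>Read \<open>h\<close> and \<open>k\<close> as densities: the images under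
  \<open>W\<close> of the measures they define are finite and have equal moments, hence
  coincide.\<close>

lemma weighted_integral_eq_if_moments_eq:
  fixes W h k :: "'a \<Rightarrow> real"
  assumes [measurable]: "W \<in> borel_measurable M" "h \<in> borel_measurable M" "k \<in> borel_measurable M"
    and W: "\<And>\<omega>. 0 \<le> W \<omega>" "\<And>\<omega>. W \<omega> \<le> 1" and h: "\<And>\<omega>. 0 \<le> h \<omega>" "\<And>\<omega>. h \<omega> \<le> 1" and k: "\<And>\<omega>. 0 \<le> k \<omega>" "\<And>\<omega>. k \<omega> \<le> 1"
    and eq: "\<And>n. expectation (\<lambda>\<omega>. h \<omega> * W \<omega> ^ n) = expectation (\<lambda>\<omega>. k \<omega> * W \<omega> ^ n)"
    and [measurable]: "B \<in> sets borel"
  shows "expectation (\<lambda>\<omega>. h \<omega> * indicator B (W \<omega>)) = expectation (\<lambda>\<omega>. k \<omega> * indicator B (W \<omega>))"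
proof -
  define \<mu> where "\<mu> f = distr (density M (\<lambda>\<omega>. ennreal (f \<omega>))) borel W" for f
  have int: "(\<integral>x. g x \<partial>\<mu> f) = expectation (\<lambda>\<omega>. f \<omega> * g (W \<omega>))"
    if [measurable]: "f \<in> borel_measurable M" "g \<in> borel_measurable borel" and "\<And>\<omega>. 0 \<le> f \<omega>" for f and g :: "real \<Rightarrow> real"
    using that(3) unfolding \<mu>_def by (simp add: integral_distr integral_density)
  have fin: "finite_measure (\<mu> f)"
    if [measurable]: "f \<in> borel_measurable M" and "\<And>\<omega>. 0 \<le> f \<omega>" "\<And>\<omega>. f \<omega> \<le> 1" for f
  proof -
    have "(\<integral>\<^sup>+\<omega>. ennreal (f \<omega>) \<partial>M) \<le> (\<integral>\<^sup>+\<omega>. 1 \<partial>M)"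
      using that(3) by (intro nn_integral_mono) (simp add: ennreal_le_1)
    then have "finite_measure (density M (\<lambda>\<omega>. ennreal (f \<omega>)))"
      by (intro finite_measureI) (auto simp: emeasure_density emeasure_space_1 top_unique cong: nn_integral_cong)
    then show ?thesis
      unfolding \<mu>_def by (intro finite_measure.finite_measure_distr) simp_all
  qed
  have "\<mu> h = \<mu> k"
  proof (rule finite_measure_eq_if_moments_eq)
    show "AE x in \<mu> h. x \<in> {0..1}" "AE x in \<mu> k. x \<in> {0..1}"
      using W unfolding \<mu>_def by (auto simp: AE_distr_iff)
    show "(\<integral>x. x ^ n \<partial>\<mu> h) = (\<integral>x. x ^ n \<partial>\<mu> k)" for n
      using h k eq[of n] by (simp add: int)
    show "finite_measure (\<mu> h)" "finite_measure (\<mu> k)"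
      using h k by (auto intro!: fin)
  qed (simp_all add: \<mu>_def)
  then have "(\<integral>x. indicat_real B x \<partial>\<mu> h) = (\<integral>x. indicator B x \<partial>\<mu> k)" by simp
  moreover have "(\<integral>x. indicator B x \<partial>\<mu> h) = expectation (\<lambda>\<omega>. h \<omega> * indicator B (W \<omega>))"
    "(\<integral>x. indicator B x \<partial>\<mu> k) = expectation (\<lambda>\<omega>. k \<omega> * indicator B (W \<omega>))"
    using h k by (intro int; simp)+
  ultimately show ?thesis by simp
qed

text \<open>A two-dimensional moment problem is avoided by replacing powers with indicators in one
  variable at a time, the other variable acting as a weight.\<close>

lemma prob_Int_eq_if_moments_factor:
  fixes U W :: "'a \<Rightarrow> real"
  assumes [measurable]: "U \<in> borel_measurable M" "W \<in> borel_measurable M"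
    and U: "\<And>\<omega>. 0 \<le> U \<omega>" "\<And>\<omega>. U \<omega> \<le> 1" and W: "\<And>\<omega>. 0 \<le> W \<omega>" "\<And>\<omega>. W \<omega> \<le> 1"
    and eq: "\<And>a b. expectation (\<lambda>\<omega>. U \<omega> ^ a * W \<omega> ^ b) =
               expectation (\<lambda>\<omega>. U \<omega> ^ a) * expectation (\<lambda>\<omega>. W \<omega> ^ b)"
    and [measurable]: "A \<in> sets borel" "B \<in> sets borel"
  shows "prob {\<omega>\<in>space M. U \<omega> \<in> A \<and> W \<omega> \<in> B} =
           prob {\<omega>\<in>space M. U \<omega> \<in> A} * prob {\<omega>\<in>space M. W \<omega> \<in> B}"
proof -
  have prob_eq: "expectation (\<lambda>\<omega>. indicator C (V \<omega>)) = prob {\<omega>\<in>space M. V \<omega> \<in> C}"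
    if [measurable]: "V \<in> borel_measurable M" "C \<in> sets borel" for V :: "'a \<Rightarrow> real" and C
  proof -
    have "expectation (\<lambda>\<omega>. indicator C (V \<omega>)) = expectation (indicator {\<omega>\<in>space M. V \<omega> \<in> C})"
      by (intro Bochner_Integration.integral_cong) (auto split: split_indicator)
    also have "\<dots> = prob ({\<omega>\<in>space M. V \<omega> \<in> C} \<inter> space M)"
      by (rule Bochner_Integration.integral_indicator)
    also have "{\<omega>\<in>space M. V \<omega> \<in> C} \<inter> space M = {\<omega>\<in>space M. V \<omega> \<in> C}" by blast
    finally show ?thesis .
  qed
  have EW: "0 \<le> expectation (\<lambda>\<omega>. W \<omega> ^ b)" "expectation (\<lambda>\<omega>. W \<omega> ^ b) \<le> 1" for b
  proof -
    show "0 \<le> expectation (\<lambda>\<omega>. W \<omega> ^ b)" using W by (intro integral_nonneg_AE) auto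
    have "expectation (\<lambda>\<omega>. W \<omega> ^ b) \<le> expectation (\<lambda>\<omega>. 1)"
      using W by (intro integral_mono integrable_const_bound[where B=1]) (auto simp: power_le_one)
    then show "expectation (\<lambda>\<omega>. W \<omega> ^ b) \<le> 1" by (simp add: prob_space)
  qed
  \<comment> \<open>With a power of \<open>W\<close> as weight, the assumed factorisation says that
    two weighted laws of \<open>U\<close> have the same moments.\<close>
  have first: "expectation (\<lambda>\<omega>. W \<omega> ^ b * indicator A (U \<omega>)) =
      expectation (\<lambda>\<omega>. expectation (\<lambda>\<omega>. W \<omega> ^ b) * indicator A (U \<omega>))" for b
    using U W EW eq by (intro weighted_integral_eq_if_moments_eq) (auto simp: power_le_one mult.commute)
  \<comment> \<open>Now the indicator of \<open>A\<close> at \<open>U\<close> is the weight, and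
    \<open>first\<close> supplies the moments in \<open>W\<close>.\<close>
  have "expectation (\<lambda>\<omega>. indicat_real A (U \<omega>) * indicator B (W \<omega>)) =
      expectation (\<lambda>\<omega>. prob {\<omega>\<in>space M. U \<omega> \<in> A} * indicator B (W \<omega>))"
  proof (rule weighted_integral_eq_if_moments_eq)
    show "expectation (\<lambda>\<omega>. indicator A (U \<omega>) * W \<omega> ^ n) =
        expectation (\<lambda>\<omega>. prob {\<omega>\<in>space M. U \<omega> \<in> A} * W \<omega> ^ n)" for n
      using first[of n] by (simp add: prob_eq mult.commute)
  qed (use W in auto)
  also have "\<dots> = prob {\<omega>\<in>space M. U \<omega> \<in> A} * prob {\<omega>\<in>space M. W \<omega> \<in> B}"
    by (simp add: prob_eq)
  also have "expectation (\<lambda>\<omega>. indicat_real A (U \<omega>) * indicator B (W \<omega>)) =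
      expectation (indicator {\<omega>\<in>space M. U \<omega> \<in> A \<and> W \<omega> \<in> B})"
    by (intro Bochner_Integration.integral_cong) (auto split: split_indicator)
  also have "\<dots> = prob ({\<omega>\<in>space M. U \<omega> \<in> A \<and> W \<omega> \<in> B} \<inter> space M)"
    by (rule Bochner_Integration.integral_indicator)
  also have "{\<omega>\<in>space M. U \<omega> \<in> A \<and> W \<omega> \<in> B} \<inter> space M = {\<omega>\<in>space M. U \<omega> \<in> A \<and> W \<omega> \<in> B}" by blast
  finally show ?thesis .
qed

lemma indep_var_ennreal_if_moments_factor:
  fixes R R' :: "'a \<Rightarrow> ennreal"
  assumes [measurable]: "R \<in> borel_measurable M" "R' \<in> borel_measurable M"
    and eq: "\<And>a b. expectation (\<lambda>\<omega>. exp_neg (R \<omega>) ^ a * exp_neg (R' \<omega>) ^ b) =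
               expectation (\<lambda>\<omega>. exp_neg (R \<omega>) ^ a) * expectation (\<lambda>\<omega>. exp_neg (R' \<omega>) ^ b)"
  shows "indep_var borel R borel R'"
  unfolding indep_var_eq
proof (intro conjI indep_set_sigma_sets indep_setI)
  have Int_stable: "Int_stable {X -` A \<inter> space M |A. A \<in> sets borel}" for X :: "'a \<Rightarrow> ennreal"
  proof (rule Int_stableI, safe)
    fix A B :: "ennreal set" assume "A \<in> sets borel" "B \<in> sets borel"
    then show "\<exists>C. X -` A \<inter> space M \<inter> (X -` B \<inter> space M) = X -` C \<inter> space M \<and> C \<in> sets borel"
      by (intro exI[of _ "A \<inter> B"]) auto
  qed
  then show "Int_stable {R -` A \<inter> space M |A. A \<in> sets borel}" "Int_stable {R' -` A \<inter> space M |A. A \<in> sets borel}"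
    by blast+
  fix a b assume "a \<in> {R -` A \<inter> space M |A. A \<in> sets borel}" "b \<in> {R' -` A \<inter> space M |A. A \<in> sets borel}"
  then obtain A B where AB: "A \<in> sets borel" "B \<in> sets borel" "a = R -` A \<inter> space M" "b = R' -` B \<inter> space M"
    by blast
  then obtain A' B' where [measurable]: "A' \<in> sets borel" "B' \<in> sets borel"
    and AB': "A = exp_neg -` A'" "B = exp_neg -` B'"
    using borel_ennreal_eq_vimage_exp_neg by metis
  have "prob {\<omega>\<in>space M. exp_neg (R \<omega>) \<in> A' \<and> exp_neg (R' \<omega>) \<in> B'} =
      prob {\<omega>\<in>space M. exp_neg (R \<omega>) \<in> A'} * prob {\<omega>\<in>space M. exp_neg (R' \<omega>) \<in> B'}"
    using eq by (intro prob_Int_eq_if_moments_factor) auto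
  moreover have "a \<inter> b = {\<omega>\<in>space M. exp_neg (R \<omega>) \<in> A' \<and> exp_neg (R' \<omega>) \<in> B'}"
    "a = {\<omega>\<in>space M. exp_neg (R \<omega>) \<in> A'}" "b = {\<omega>\<in>space M. exp_neg (R' \<omega>) \<in> B'}"
    using AB AB' by auto
  ultimately show "prob (a \<inter> b) = prob a * prob b" by simp
qed (auto intro: measurable_sets)

end

text \<open>Pushing both laws forward along \<open>exp_neg\<close> reduces the claim to the unit
  interval, and \<open>borel_ennreal_eq_vimage_exp_neg\<close> brings it back.\<close>

lemma ennreal_measure_eq_if_moments_eq:
  fixes \<mu> \<nu> :: "ennreal measure"
  assumes "prob_space \<mu>" and [simp, measurable_cong]: "sets \<mu> = sets borel"
    and "prob_space \<nu>" and [simp, measurable_cong]: "sets \<nu> = sets borel"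
    and eq: "\<And>n. (\<integral>x. exp_neg x ^ n \<partial>\<mu>) = (\<integral>x. exp_neg x ^ n \<partial>\<nu>)"
  shows "\<mu> = \<nu>"
proof (rule measure_eqI)
  interpret \<mu>: prob_space \<mu> by fact
  interpret \<nu>: prob_space \<nu> by fact
  have sp [simp]: "space \<mu> = UNIV" "space \<nu> = UNIV"
    using sets_eq_imp_space_eq[OF assms(2)] sets_eq_imp_space_eq[OF assms(4)] by simp_all
  have distr_eq: "distr \<mu> borel exp_neg = distr \<nu> borel exp_neg"
    using eq by (intro prob_measure_eq_if_moments_eq \<mu>.prob_space_distr \<nu>.prob_space_distr)
      (auto simp: AE_distr_iff integral_distr)
  fix A assume "A \<in> sets \<mu>"
  then obtain B where B: "B \<in> sets borel" "A = exp_neg -` B"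
    using borel_ennreal_eq_vimage_exp_neg[of A] by auto
  then have "emeasure \<mu> A = emeasure (distr \<mu> borel exp_neg) B"
    "emeasure \<nu> A = emeasure (distr \<nu> borel exp_neg) B"
    by (simp_all add: emeasure_distr)
  then show "emeasure \<mu> A = emeasure \<nu> A"
    by (simp add: distr_eq)
qed simp

subsection \<open>The functional equation\<close>

definition laplace :: "ennreal measure \<Rightarrow> nat \<Rightarrow> real" where
  "laplace \<mu> n = (\<integral>x. exp_neg x ^ n \<partial>\<mu>)"

text \<open>Dividing by \<open>f a * f b * f (a + b)\<close> gives
  \<open>1 / f (a + b) = 1 / f a + 1 / f b - 1\<close>. On natural arguments the additive function
  \<open>1 / f - 1\<close> is linear by induction, its slope \<open>c\<close> is its value at 1, and
  the rate is \<open>1 / c\<close>.\<close>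

lemma hyperbolic_if_functional_eq:
  fixes f :: "nat \<Rightarrow> real"
  assumes pos: "\<And>n. 0 < f n" and "f 0 = 1" and "f 1 < 1"
    and fe: "\<And>a b. f (a + b) * (f a + f b - f a * f b) = f a * f b"
  shows "\<exists>\<theta>>0. \<forall>n. f n = \<theta> / (\<theta> + real n)"
proof -
  define c where "c = 1 / f 1 - 1"
  have "c > 0" using pos[of 1] \<open>f 1 < 1\<close> by (simp add: c_def)
  have add: "1 / f (a + b) = 1 / f a + 1 / f b - 1" for a b
    using fe[of a b] pos[of a] pos[of b] pos[of "a + b"] by (simp add: field_simps)
  have "1 / f n = 1 + c * real n" for n
  proof (induction n)
    case (Suc n)
    have "c * real (Suc n) = c * real n + c" by (simp add: algebra_simps)
    with Suc show ?case using add[of n 1] by (simp add: c_def)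
  qed (simp add: \<open>f 0 = 1\<close>)
  then have "f n = 1 / (1 + c * real n)" for n
    by (metis div_by_1 divide_divide_eq_right mult_1)
  then have "f n = (1 / c) / (1 / c + real n)" for n
    using \<open>c > 0\<close> by (simp add: field_simps)
  then show ?thesis using \<open>c > 0\<close> by (intro exI[of _ "1 / c"]) auto
qed

section \<open>Laplace transforms of laws on the extended half-line\<close>

locale ennreal_prob = prob_space \<mu> for \<mu> :: "ennreal measure" +
  assumes sets_eq [simp, measurable_cong]: "sets \<mu> = sets borel"
begin

lemma space_eq [simp]: "space \<mu> = UNIV"
  using sets_eq_imp_space_eq[OF sets_eq] by simp

lemma integrable_exp_neg_power [simp]: "integrable \<mu> (\<lambda>x. exp_neg x ^ n)"
  by (intro integrable_const_bound[where B=1]) (auto simp: power_le_one)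

lemma laplace_0 [simp]: "laplace \<mu> 0 = 1"
  by (simp add: laplace_def prob_space[simplified])

lemma laplace_antimono: "m \<le> n \<Longrightarrow> laplace \<mu> n \<le> laplace \<mu> m"
  unfolding laplace_def by (intro integral_mono) (auto intro: power_decreasing)

lemma laplace_le_1: "laplace \<mu> n \<le> 1"
  using laplace_antimono[of 0 n] by simp

lemma laplace_nonneg: "0 \<le> laplace \<mu> n"
  unfolding laplace_def by (intro integral_nonneg_AE) auto

text \<open>\<open>exp_neg x ^ n\<close> tends to 1 at \<open>x = 0\<close> and to 0 elsewhere.
  Through this limit the atoms at 0 enter the functional equation.\<close>

lemma laplace_tendsto: "laplace \<mu> \<longlonglongrightarrow> measure \<mu> {0}"
proof -
  have "(\<lambda>n. \<integral>x. exp_neg x ^ n \<partial>\<mu>) \<longlonglongrightarrow> (\<integral>x. indicator {0} x \<partial>\<mu>)"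
  proof (rule integral_dominated_convergence[where w="\<lambda>_. 1"])
    show "AE x in \<mu>. (\<lambda>n. exp_neg x ^ n) \<longlonglongrightarrow> indicator {0} x"
    proof (rule AE_I2)
      fix x
      show "(\<lambda>n. exp_neg x ^ n) \<longlonglongrightarrow> indicator {0} x"
      proof (cases "x = 0")
        case False
        then have "exp_neg x < 1" by (cases x) auto
        then have "(\<lambda>n. exp_neg x ^ n) \<longlonglongrightarrow> 0" by (intro LIMSEQ_power_zero) auto
        then show ?thesis using False by simp
      qed simp
    qed
  qed (auto simp: power_le_one)
  then show ?thesis by (simp add: laplace_def[abs_def])
qed

lemma measure_0_le_laplace: "measure \<mu> {0} \<le> laplace \<mu> n"
  using laplace_tendsto by (rule LIMSEQ_le_const2) (auto intro!: exI[of _ n] laplace_antimono)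

text \<open>Keep only the part of the integral over values up to \<open>r\<close>. Mass near 0
  thereby limits how fast the transform can decay.\<close>

lemma laplace_ge:
  assumes "0 \<le> r" shows "exp (- r) ^ n * measure \<mu> {..ennreal r} \<le> laplace \<mu> n"
proof -
  have "exp (- r) ^ n * measure \<mu> {..ennreal r} = (\<integral>x. exp (- r) ^ n * indicator {..ennreal r} x \<partial>\<mu>)"
    by simp
  also have "\<dots> \<le> laplace \<mu> n"
    unfolding laplace_def
  proof (rule integral_mono)
    fix x show "exp (- r) ^ n * indicator {..ennreal r} x \<le> exp_neg x ^ n"
      using assms by (cases x) (auto simp: indicator_def top_unique intro!: power_mono)
  qed (auto simp: emeasure_eq_measure less_top[symmetric])
  finally show ?thesis .
qed

end

section \<open>Solving the functional equation when there is mass near 0\<close>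

lemma lattice_in_borel: "insert \<infinity> (range h) \<in> sets borel" for h :: "nat \<Rightarrow> ennreal"
  by (rule sets.countable) simp_all

text \<open>Here \<open>\<nu>\<close> will be the law of \<open>T 1\<close> and \<open>\<mu>\<close>
  that of \<open>T 2\<close>. The locale separates the analytic problem behind claim (1) from the
  probability space.\<close>

locale functional_eq = nu: ennreal_prob \<nu> + mu: ennreal_prob \<mu> for \<nu> \<mu> +
  assumes functional_eq: "laplace \<nu> (a + b) * (laplace \<mu> a + laplace \<mu> b - laplace \<mu> a * laplace \<mu> b) =
    laplace \<nu> a * laplace \<nu> b"
    and near_0: "0 < \<epsilon> \<Longrightarrow> 0 < measure \<nu> {..<ennreal \<epsilon>}"
begin

abbreviation "f \<equiv> laplace \<mu>"
abbreviation "g \<equiv> laplace \<nu>"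
abbreviation "F \<equiv> measure \<mu> {0}"

lemma measure_atMost_pos: "0 < r \<Longrightarrow> 0 < measure \<nu> {..ennreal r}"
proof -
  assume "0 < r"
  then have "0 < measure \<nu> {..<ennreal r}" by (rule near_0)
  also have "\<dots> \<le> measure \<nu> {..ennreal r}"
    by (rule nu.finite_measure_mono) auto
  finally show ?thesis .
qed

lemma g_pos: "0 < g n"
  using nu.laplace_ge[of 1 n] measure_atMost_pos[of 1]
  by (smt (verit) exp_gt_zero mult_pos_pos zero_less_power)

text \<open>Iterating the functional equation bounds \<open>g (a * m)\<close> by the \<open>m\<close>-th power of
  \<open>g a / (f a + F - f a * F)\<close>; since \<open>\<nu>\<close> charges every neighbourhood of \<open>0\<close>, this quotient
  cannot be below \<open>1\<close>.\<close>

lemma g_eq: "g a = f a + F - f a * F"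
proof (cases "a = 0")
  case False
  define D where "D = f a + F - f a * F"
  have f1: "f n \<le> 1" "0 \<le> f n" for n
    using mu.laplace_le_1 mu.laplace_nonneg by auto
  \<comment> \<open>Replace \<open>g (a + b)\<close> by the larger \<open>g b\<close> in the
    functional equation, cancel \<open>g b\<close>, and let \<open>b\<close> tend to
    infinity.\<close>
  have "g a \<le> D"
  proof (rule LIMSEQ_le_const)
    show "(\<lambda>b. f a + f b - f a * f b) \<longlonglongrightarrow> D"
      unfolding D_def by (intro tendsto_intros mu.laplace_tendsto)
    have "g a \<le> f a + f b - f a * f b" for b
    proof -
      have "f a * f b \<le> f a * 1" using f1 by (intro mult_left_mono) auto
      then have "0 \<le> f a + f b - f a * f b" using f1[of b] by simp
      then have "g a * g b \<le> g b * (f a + f b - f a * f b)"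
        unfolding functional_eq[symmetric] by (intro mult_right_mono nu.laplace_antimono) auto
      then show ?thesis using g_pos[of b] by (simp add: mult.commute)
    qed
    then show "\<exists>N. \<forall>n\<ge>N. g a \<le> f a + f n - f a * f n" by blast
  qed
  moreover have "\<not> g a < D"
  proof
    assume less: "g a < D"
    have "D > 0" using less g_pos[of a] by simp
    \<comment> \<open>The atom \<open>F\<close> is at most \<open>f b\<close>, so \<open>D\<close>
      is a lower bound, uniform in \<open>b\<close>, for the factor in the functional
      equation.\<close>
    have step: "g (a + b) * D \<le> g a * g b" for b
    proof -
      have "F * (1 - f a) \<le> f b * (1 - f a)"
        using f1 mu.measure_0_le_laplace by (intro mult_right_mono) auto
      then have "D \<le> f a + f b - f a * f b" by (simp add: D_def algebra_simps)
      then show ?thesis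
        unfolding functional_eq[symmetric] by (intro mult_left_mono nu.laplace_nonneg)
    qed
    have iter: "g (a * m) * D ^ m \<le> g a ^ m" for m
    proof (induction m)
      case (Suc m)
      have "g (a * Suc m) * D ^ Suc m = (g (a + a * m) * D) * D ^ m" by simp
      also have "\<dots> \<le> (g a * g (a * m)) * D ^ m"
        using step[of "a * m"] \<open>D > 0\<close> by (intro mult_right_mono) auto
      also have "\<dots> = g a * (g (a * m) * D ^ m)" by simp
      also have "\<dots> \<le> g a * g a ^ m"
        using Suc nu.laplace_nonneg[of a] by (intro mult_left_mono)
      finally show ?case by simp
    qed simp
    \<comment> \<open>This choice makes \<open>exp (- r) ^ a\<close> the square root of
      \<open>g a / D\<close>, so \<open>s\<close> is the square root of \<open>D / g a\<close> and
      still exceeds 1. Then \<open>s ^ m * P\<close> is unbounded in \<open>m\<close>, although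
      \<open>laplace_ge\<close> and \<open>iter\<close> bound it by 1.\<close>
    define r where "r = ln (D / g a) / (2 * a)"
    have "r > 0"
      using less g_pos[of a] False by (simp add: r_def)
    define P where "P = measure \<nu> {..ennreal r}"
    have "P > 0" using measure_atMost_pos \<open>r > 0\<close> by (simp add: P_def)
    define s where "s = exp (- r) ^ a * (D / g a)"
    have "exp (- r) ^ a = exp (- (ln (D / g a) / 2))"
      using False by (simp add: exp_of_nat_mult[symmetric] r_def)
    moreover have "D / g a = exp (ln (D / g a))"
      using \<open>D > 0\<close> g_pos[of a] by simp
    ultimately have "s = exp (- (ln (D / g a) / 2)) * exp (ln (D / g a))"
      by (simp only: s_def)
    then have "s = exp (ln (D / g a) / 2)"
      unfolding mult_exp_exp by (simp add: field_simps)
    then have "s > 1" using less g_pos[of a] by simp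
    then obtain m where m: "1 / P < s ^ m" using real_arch_pow by blast
    have "s ^ m * P = exp (- r) ^ (a * m) * P * D ^ m / g a ^ m"
      by (simp add: s_def power_mult_distrib power_divide power_mult)
    also have "\<dots> \<le> g (a * m) * D ^ m / g a ^ m"
      using nu.laplace_ge[of r "a * m"] \<open>r > 0\<close> \<open>D > 0\<close> g_pos[of a]
      unfolding P_def by (intro divide_right_mono mult_right_mono) auto
    also have "\<dots> \<le> 1" using iter[of m] g_pos[of a] by simp
    finally show False using m \<open>P > 0\<close> by (simp add: field_simps)
  qed
  ultimately show ?thesis unfolding D_def by simp
qed simp

text \<open>Let \<open>a\<close> tend to infinity in \<open>g_eq\<close>. The value equals
  \<open>1 - (1 - F)\<^sup>2\<close>.\<close>

lemma measure_nu_0: "measure \<nu> {0} = 2 * F - F\<^sup>2"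
proof (rule LIMSEQ_unique[OF nu.laplace_tendsto])
  have "(\<lambda>a. f a + F - f a * F) \<longlonglongrightarrow> F + F - F * F"
    by (intro tendsto_intros mu.laplace_tendsto)
  then show "g \<longlonglongrightarrow> 2 * F - F\<^sup>2"
    by (simp add: g_eq[symmetric] power2_eq_square)
qed

text \<open>If \<open>f 1 = 1\<close>, then \<open>g 1 = 1\<close> by \<open>g_eq\<close>, and the
  functional equation with \<open>a = 1\<close> keeps \<open>g\<close> equal to 1. So
  \<open>\<nu>\<close> is concentrated at 0, and \<open>measure_nu_0\<close> forces
  \<open>F = 1\<close>.\<close>

lemma f_1_less_1:
  assumes "F < 1" shows "f 1 < 1"
proof (rule ccontr)
  assume "\<not> ?thesis"
  then have f1: "f 1 = 1" using mu.laplace_le_1[of 1] by simp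
  then have g1: "g 1 = 1" by (simp add: g_eq)
  have "g n = 1" for n
  proof (induction n)
    case (Suc n)
    then show ?case using functional_eq[of 1 n] f1 g1 by simp
  qed simp
  then have "g = (\<lambda>_. 1)" by auto
  then have "measure \<nu> {0} = 1"
    using nu.laplace_tendsto by (simp add: LIMSEQ_const_iff)
  then have "(1 - F)\<^sup>2 = 0"
    by (simp add: measure_nu_0 power2_eq_square algebra_simps)
  then show False using assms by simp
qed

lemma exponential_if_F_0:
  assumes "F = 0"
  shows "\<exists>\<theta>>0. \<forall>n. f n = \<theta> / (\<theta> + real n) \<and> g n = \<theta> / (\<theta> + real n)"
proof -
  have eq: "g n = f n" for n using g_eq[of n] assms by simp
  have "\<exists>\<theta>>0. \<forall>n. f n = \<theta> / (\<theta> + real n)"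
  proof (rule hyperbolic_if_functional_eq)
    show "0 < f n" for n using g_pos[of n] unfolding eq .
    show "f 1 < 1" using f_1_less_1 assms by simp
    show "f (a + b) * (f a + f b - f a * f b) = f a * f b" for a b
      using functional_eq[of a b] unfolding eq .
  qed (rule mu.laplace_0)
  then show ?thesis unfolding eq by blast
qed

text \<open>The factor in the functional equation is \<open>1 - (1 - f a) * (1 - f b)\<close>, and
  by \<open>g_eq\<close> each \<open>1 - f\<close> is \<open>(1 - g) / k\<close> with
  \<open>k = 1 - F\<close>. This leaves an equation for \<open>g\<close> alone, and in the
  coordinate \<open>(1 - (1 - k\<^sup>2) / g n) / k\<^sup>2\<close> it says that the coordinate is
  multiplicative, hence equal to \<open>r ^ n\<close>. Solving for \<open>f\<close> and expanding a
  geometric series exhibits \<open>\<mu>\<close> as a law on a lattice.\<close>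

lemma arithmetic_if_F_pos:
  assumes "0 < F"
  shows "\<exists>\<alpha>>0. measure \<mu> (insert \<infinity> (range (\<lambda>n::nat. ennreal (\<alpha> * real n)))) = 1"
proof (cases "F = 1")
  \<comment> \<open>Here all of \<open>\<mu>\<close> sits at 0, which lies on every lattice.\<close>
  case True
  have "{0} \<subseteq> insert \<infinity> (range (\<lambda>n::nat. ennreal (1 * real n)))"
    by (auto intro!: image_eqI[of _ _ 0])
  then   have "F \<le> measure \<mu> (insert \<infinity> (range (\<lambda>n::nat. ennreal (1 * real n))))"
    by (rule mu.finite_measure_mono) (simp add: lattice_in_borel del: infinity_ennreal_def)
  then show ?thesis
    using True mu.prob_le_1 by (intro exI[of _ 1]) (auto intro: antisym)
next
  case False
  define k where "k = 1 - F"
  have k: "0 < k" "k < 1" using assms False mu.prob_le_1[of "{0}"] by (auto simp: k_def less_le)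
  have k2: "0 < k\<^sup>2" "k\<^sup>2 < 1" using k by (auto simp: power_less_one_iff abs_square_less_1)
  have gk: "g n = 1 - k * (1 - f n)" for n by (simp add: g_eq k_def algebra_simps)
  \<comment> \<open>The multiplicative coordinate at \<open>n = 1\<close>. It is nonnegative because
    \<open>1 - k\<^sup>2\<close> is the atom of \<open>\<nu>\<close> at 0 and so at most
    \<open>g 1\<close>; it is below 1 because \<open>g 1 < 1\<close>.\<close>
  define r where "r = (1 - (1 - k\<^sup>2) / g 1) / k\<^sup>2"
  have "1 - k\<^sup>2 \<le> g 1"
    using nu.measure_0_le_laplace[of 1] measure_nu_0 by (simp add: k_def power2_eq_square algebra_simps)
  then have "0 \<le> r" using k2 g_pos[of 1] by (simp add: r_def)
  have "g 1 < 1"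
    using f_1_less_1 k gk[of 1] by (simp add: k_def)
  then have "(1 - k\<^sup>2) / g 1 > 1 - k\<^sup>2"
    using k2 g_pos[of 1] by (simp add: less_divide_eq)
  then have "r < 1" using k2 by (simp add: r_def field_simps)
  have kr: "k\<^sup>2 * r ^ n < 1" for n
  proof -
    have "k\<^sup>2 * r ^ n \<le> k\<^sup>2 * 1"
      using \<open>0 \<le> r\<close> \<open>r < 1\<close> k2 by (intro mult_left_mono power_le_one) auto
    then show ?thesis using k2(2) unfolding mult_1_right by (rule le_less_trans)
  qed
  have g1: "g 1 * (1 - k\<^sup>2 * r) = 1 - k\<^sup>2"
    using g_pos[of 1] k2 by (simp add: r_def field_simps)
  have g_formula: "g n * (1 - k\<^sup>2 * r ^ n) = 1 - k\<^sup>2" for n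
  proof (induction n)
    case (Suc n)
    \<comment> \<open>Denominators are cleared by the factor \<open>u * v\<close>, with
      \<open>u\<close> belonging to \<open>n\<close> and \<open>v\<close> to 1. The step rests on
      the identity \<open>(1 - k\<^sup>2 * x) * (1 - k\<^sup>2 * r) - k\<^sup>2 * (1 - x) * (1 - r)
      = (1 - k\<^sup>2) * (1 - k\<^sup>2 * (x * r))\<close>.\<close>
    define x where "x = r ^ n"
    define u v where "u = 1 - k\<^sup>2 * x" and "v = 1 - k\<^sup>2 * r"
    have "u > 0" "v > 0" using kr[of n] kr[of 1] by (auto simp: u_def v_def x_def)
    have gn: "g n * u = 1 - k\<^sup>2" and g1': "g 1 * v = 1 - k\<^sup>2"
      using Suc g1 by (simp_all add: u_def v_def x_def)
    have fn: "k * (1 - f n) * u = k\<^sup>2 * (1 - x)"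
    proof -
      have "k * (1 - f n) * u = u - g n * u" by (simp add: gk algebra_simps)
      then show ?thesis unfolding gn by (simp add: u_def algebra_simps)
    qed
    have f1: "k * (1 - f 1) * v = k\<^sup>2 * (1 - r)"
    proof -
      have "k * (1 - f 1) * v = v - g 1 * v" by (simp add: gk algebra_simps)
      then show ?thesis unfolding g1' by (simp add: v_def algebra_simps)
    qed
    have fn': "(1 - f n) * u = k * (1 - x)" and f1': "(1 - f 1) * v = k * (1 - r)"
      using fn f1 k by (simp_all add: power2_eq_square mult.assoc)
    have "(1 - f n) * (1 - f 1) * (u * v) = ((1 - f n) * u) * ((1 - f 1) * v)"
      by (simp only: ac_simps)
    then have "(1 - (1 - f n) * (1 - f 1)) * (u * v) = u * v - k\<^sup>2 * (1 - x) * (1 - r)"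
      unfolding fn' f1' by (simp add: algebra_simps power2_eq_square)
    also have "\<dots> = (1 - k\<^sup>2) * (1 - k\<^sup>2 * (x * r))"
      unfolding u_def v_def by (simp add: algebra_simps power2_eq_square)
    finally have ff: "(1 - (1 - f n) * (1 - f 1)) * (u * v) = (1 - k\<^sup>2) * (1 - k\<^sup>2 * (x * r))" .
    have "g (n + 1) * (1 - (1 - f n) * (1 - f 1)) = g n * g 1"
      using functional_eq[of n 1] by (simp add: algebra_simps)
    from arg_cong[OF this, of "\<lambda>y. y * (u * v)"]
    have "g (n + 1) * ((1 - (1 - f n) * (1 - f 1)) * (u * v)) = (g n * u) * (g 1 * v)"
      by (simp only: ac_simps)
    then have "g (n + 1) * (1 - k\<^sup>2 * (x * r)) * (1 - k\<^sup>2) = (1 - k\<^sup>2) * (1 - k\<^sup>2)"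
      unfolding ff gn g1' by (simp add: ac_simps)
    then have "g (n + 1) * (1 - k\<^sup>2 * (x * r)) = 1 - k\<^sup>2"
      using k2 by simp
    then show ?case by (simp add: x_def mult.commute)
  qed simp
  have f_formula: "f n = 1 - 1 / k + (1 - k\<^sup>2) / k * (1 / (1 - k\<^sup>2 * r ^ n))" for n
  proof -
    have "g n = (1 - k\<^sup>2) / (1 - k\<^sup>2 * r ^ n)"
      using g_formula[of n] kr[of n] by (simp add: field_simps)
    moreover have "f n = 1 - (1 - g n) / k" using gk[of n] k by simp
    ultimately show ?thesis using k by (simp add: diff_divide_distrib mult.commute)
  qed
  \<comment> \<open>The coefficients of the geometric series in \<open>f_formula\<close>, with the
    constant absorbed at index 0, where the total is \<open>1 - k\<close>. They become the point
    masses of \<open>\<mu>\<close>.\<close>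
  define c where "c j = (1 - k\<^sup>2) / k * (k\<^sup>2) ^ j + (if j = 0 then 1 - 1 / k else 0)" for j :: nat
  have c_nonneg: "0 \<le> c j" for j
  proof (cases "j = 0")
    case True
    then have "c j = 1 - k" using k by (simp add: c_def field_simps power2_eq_square)
    then show ?thesis using k by simp
  qed (use k k2 in \<open>simp add: c_def\<close>)
  have c_sums: "(\<lambda>j. c j * (r ^ j) ^ n) sums f n" for n
  proof -
    have "(\<lambda>j. (k\<^sup>2 * r ^ n) ^ j) sums (1 / (1 - k\<^sup>2 * r ^ n))"
      using kr[of n] k2 \<open>0 \<le> r\<close> by (intro geometric_sums) auto
    from sums_add[OF sums_mult[OF this, of "(1 - k\<^sup>2) / k"] sums_single[of 0 "\<lambda>_. 1 - 1 / k"]]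
    have "(\<lambda>j. (1 - k\<^sup>2) / k * (k\<^sup>2 * r ^ n) ^ j + (if j = 0 then 1 - 1 / k else 0)) sums f n"
      by (simp add: f_formula add.commute)
    moreover have "(1 - k\<^sup>2) / k * (k\<^sup>2 * r ^ n) ^ j + (if j = 0 then 1 - 1 / k else 0) = c j * (r ^ j) ^ n" for j
      by (simp add: c_def power_mult_distrib power_mult[symmetric] mult.commute)
    ultimately show ?thesis by simp
  qed
  \<comment> \<open>The span solves \<open>exp (- \<alpha>) = r\<close>. For \<open>r = 0\<close>
    the law lives on 0 and infinity: any span serves, and \<open>t\<close> sends every nonzero index
    to infinity, in accordance with \<open>0 ^ 0 = 1\<close>.\<close>
  define \<alpha> where "\<alpha> = (if r = 0 then 1 else - ln r)"
  have "\<alpha> > 0" using \<open>0 \<le> r\<close> \<open>r < 1\<close> by (simp add: \<alpha>_def)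
  define t where "t j = (if r = 0 \<and> j \<noteq> 0 then \<infinity> else ennreal (\<alpha> * real j))" for j :: nat
  have exp_t: "exp_neg (t j) = r ^ j" for j
  proof (cases "r = 0")
    case False
    then have "exp (- (\<alpha> * real j)) = exp (ln r) ^ j"
      by (simp add: \<alpha>_def exp_of_nat_mult[symmetric] mult.commute)
    then show ?thesis using False \<open>0 \<le> r\<close> \<open>\<alpha> > 0\<close> by (simp add: t_def)
  qed (auto simp: t_def \<alpha>_def)
  define C where "C = density (count_space UNIV) (\<lambda>j. ennreal (c j))"
  have C_int: "(\<integral>j. (r ^ j) ^ n \<partial>C) = f n" for n
  proof -
    have "(\<integral>j. (r ^ j) ^ n \<partial>C) = (\<integral>j. c j * (r ^ j) ^ n \<partial>count_space UNIV)"
      unfolding C_def using c_nonneg by (subst integral_density) auto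
    also have "\<dots> = (\<Sum>j. c j * (r ^ j) ^ n)"
      using c_sums[of n] c_nonneg \<open>0 \<le> r\<close>
      by (intro integral_count_space_nat) (auto simp: integrable_count_space_nat_iff abs_mult sums_iff)
    finally show ?thesis using c_sums[of n] by (simp add: sums_iff)
  qed
  have "emeasure C (space C) = (\<Sum>j. ennreal (c j))"
    unfolding C_def by (simp add: emeasure_density nn_integral_count_space_nat)
  also have "\<dots> = ennreal 1"
    using c_sums[of 0] c_nonneg by (subst suminf_ennreal2) (auto simp: sums_iff)
  finally interpret C: prob_space C by (intro prob_spaceI) simp
  have [measurable]: "t \<in> measurable C borel" by (simp add: C_def)
  have "\<mu> = distr C borel t"
  proof (rule ennreal_measure_eq_if_moments_eq)
    show "prob_space (distr C borel t)" by (intro C.prob_space_distr) simp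
    show "(\<integral>x. exp_neg x ^ n \<partial>\<mu>) = (\<integral>x. exp_neg x ^ n \<partial>distr C borel t)" for n
      by (subst integral_distr) (simp_all add: exp_t C_int laplace_def[symmetric])
  qed (auto intro: mu.prob_space_axioms)
  then have "measure \<mu> (insert \<infinity> (range (\<lambda>n::nat. ennreal (\<alpha> * real n)))) =
    measure C (t -` (insert \<infinity> (range (\<lambda>n::nat. ennreal (\<alpha> * real n)))) \<inter> space C)"
    by (simp add: measure_distr lattice_in_borel del: infinity_ennreal_def)
  also have "t -` (insert \<infinity> (range (\<lambda>n::nat. ennreal (\<alpha> * real n)))) \<inter> space C = space C"
    by (auto simp: t_def)
  finally show ?thesis using \<open>\<alpha> > 0\<close> C.prob_space by auto
qed

lemma exponential_if_not_arithmetic: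
  assumes "\<not> (\<exists>\<alpha>>0. measure \<mu> (insert \<infinity> (range (\<lambda>n::nat. ennreal (\<alpha> * real n)))) = 1) \<or>
    measure \<nu> {0} = 0"
  shows "\<exists>\<theta>>0. \<forall>n. f n = \<theta> / (\<theta> + real n) \<and> g n = \<theta> / (\<theta> + real n)"
proof (rule exponential_if_F_0)
  from assms show "F = 0"
  proof
    assume "measure \<nu> {0} = 0"
    then have "F * (2 - F) = 0" by (simp add: measure_nu_0 power2_eq_square algebra_simps)
    then show "F = 0" using mu.prob_le_1[of "{0}"] by auto
  qed (use arithmetic_if_F_pos measure_nonneg[of \<mu> "{0}"] in \<open>auto simp: less_le\<close>)
qed

end

subsection \<open>The renewal process with exponential interarrival times\<close>

text \<open>\<open>erlang_density k\<close> has shape \<open>k + 1\<close>, so this is the law of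
  the arrival time of index \<open>k + 1\<close> for exponential gaps, moved to the extended
  half-line.\<close>

definition erlang_law :: "nat \<Rightarrow> real \<Rightarrow> ennreal measure" where
  "erlang_law k \<theta> = distr (density lborel (erlang_density k \<theta>)) borel ennreal"

abbreviation exponential_law :: "real \<Rightarrow> ennreal measure" where
  "exponential_law \<equiv> erlang_law 0"

lemma sets_erlang_law [simp, measurable_cong]: "sets (erlang_law k \<theta>) = sets borel"
  by (simp add: erlang_law_def)

lemma space_erlang_law [simp]: "space (erlang_law k \<theta>) = UNIV"
  by (simp add: erlang_law_def)

lemma prob_space_erlang_law: "0 < \<theta> \<Longrightarrow> prob_space (erlang_law k \<theta>)"
  unfolding erlang_law_def
  by (intro prob_space.prob_space_distr prob_space_erlang_density) auto

text \<open>Multiplication by \<open>exp (- x) ^ n\<close> tilts the Erlang density of rate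
  \<open>\<theta>\<close> into a multiple of the one of rate \<open>\<theta> + n\<close>, whose
  integral is 1.\<close>

lemma laplace_erlang_law:
  assumes "0 < \<theta>"
  shows "laplace (erlang_law k \<theta>) n = (\<theta> / (\<theta> + real n)) ^ Suc k"
proof -
  have dens: "erlang_density k \<theta> x * exp_neg (ennreal x) ^ n =
      (\<theta> / (\<theta> + real n)) ^ Suc k * erlang_density k (\<theta> + real n) x" for x
  proof (cases "x < 0")
    case False
    have "exp (- (\<theta> * x)) * exp (- x) ^ n = exp (- ((\<theta> + real n) * x))"
      by (simp add: exp_of_nat_mult[symmetric] mult_exp_exp algebra_simps)
    moreover have "(\<theta> / (\<theta> + real n)) ^ Suc k * (\<theta> + real n) ^ Suc k = \<theta> ^ Suc k"
      using assms unfolding power_mult_distrib[symmetric] by simp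
    ultimately show ?thesis
      using False by (simp add: erlang_density_def mult.assoc[symmetric] mult.commute[of _ "exp _"] del: power_Suc,
          simp add: mult.assoc del: power_Suc, simp add: algebra_simps)
  qed (simp add: erlang_density_def)
  interpret P: prob_space "density lborel (erlang_density k (\<theta> + real n))"
    using assms by (intro prob_space_erlang_density) simp
  have "(\<integral>x. erlang_density k (\<theta> + real n) x \<partial>lborel) = (\<integral>x. 1 \<partial>density lborel (erlang_density k (\<theta> + real n)))"
    using assms by (subst integral_density) auto
  also have "\<dots> = 1" using P.prob_space by simp
  finally have total: "(\<integral>x. erlang_density k (\<theta> + real n) x \<partial>lborel) = 1" .
  have "laplace (erlang_law k \<theta>) n = (\<integral>x. erlang_density k \<theta> x * exp_neg (ennreal x) ^ n \<partial>lborel)"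
    unfolding laplace_def erlang_law_def
    using assms by (simp add: integral_distr integral_density)
  then show ?thesis
    unfolding dens using total by simp
qed

definition poisson_mass :: "real \<Rightarrow> nat \<Rightarrow> real" where
  "poisson_mass r k = r ^ k * exp (- r) / fact k"

lemma poisson_mass_nonneg [simp]: "0 \<le> r \<Longrightarrow> 0 \<le> poisson_mass r k"
  by (simp add: poisson_mass_def)

lemma poisson_mass_sums: "poisson_mass r sums 1"
proof -
  have "(\<lambda>k. exp (- r) * (r ^ k /\<^sub>R fact k)) sums (exp (- r) * exp r)"
    by (intro sums_mult exp_converges)
  then show ?thesis
    by (simp add: poisson_mass_def[abs_def] mult_exp_exp field_simps)
qed

text \<open>\<open>N\<close> is at level \<open>c\<close> at time \<open>s\<close>; an entry \<open>(d, k)\<close> asks for an increment \<open>k\<close> over the next time span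
  of length \<open>d\<close>.\<close>

fun increments_eq :: "(real \<Rightarrow> enat) \<Rightarrow> real \<Rightarrow> nat \<Rightarrow> (real \<times> nat) list \<Rightarrow> bool" where
  "increments_eq N s c [] = True"
| "increments_eq N s c ((d, k) # L) \<longleftrightarrow>
     N (s + d) = enat (c + k) \<and> increments_eq N (s + d) (c + k) L"

text \<open>Needed in two situations: after the first arrival, where the tail of the stream runs one
  level lower, and at a restart in the middle of the first gap, where only time is shifted.\<close>

lemma increments_eq_shift:
  assumes "\<And>t j. s \<le> t \<Longrightarrow> N t = enat (c + j) \<longleftrightarrow> N' (t - s + s') = enat (c' + j)"
    and "s \<le> t" "list_all (\<lambda>(d, k). 0 \<le> d) L"
  shows "increments_eq N t (c + m) L \<longleftrightarrow> increments_eq N' (t - s + s') (c' + m) L"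
  using assms(2,3)
proof (induction L arbitrary: t m)
  case (Cons a L)
  obtain d k where a: "a = (d, k)" by force
  have "d \<ge> 0" using Cons.prems a by simp
  then have "increments_eq N (t + d) (c + (m + k)) L \<longleftrightarrow> increments_eq N' (t + d - s + s') (c' + (m + k)) L"
    using Cons.prems by (intro Cons.IH) auto
  moreover have "N (t + d) = enat (c + (m + k)) \<longleftrightarrow> N' (t + d - s + s') = enat (c' + (m + k))"
    using assms(1) Cons.prems \<open>d \<ge> 0\<close> by auto
  moreover have "t + d - s + s' = t - s + s' + d" by simp
  ultimately show ?case by (simp add: a add.assoc)
qed simp

text \<open>Arrival indices start at 1, stream positions at 0. Streams are chosen because the law of
  an independent sequence splits there into head and tail, which amounts to conditioning on the
  first arrival.\<close>

definition stream_entry :: "nat \<Rightarrow> 'b stream \<Rightarrow> 'b" where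
  "stream_entry i \<omega> = \<omega> !! (i - 1)"

definition stream_renewal :: "ennreal stream \<Rightarrow> real \<Rightarrow> enat" where
  "stream_renewal \<omega> t = renewal_process stream_entry t \<omega>"

lemma arrival_time_Stream:
  "arrival_time stream_entry (Suc n) (x ## \<omega>) = x + arrival_time stream_entry n \<omega>"
proof (induction n)
  case (Suc n)
  have "arrival_time stream_entry (Suc (Suc n)) (x ## \<omega>) =
    arrival_time stream_entry (Suc n) (x ## \<omega>) + \<omega> !! n"
    by (subst arrival_time_Suc) (simp add: stream_entry_def)
  also have "\<dots> = x + arrival_time stream_entry (Suc n) \<omega>"
    unfolding Suc by (simp add: arrival_time_Suc add.assoc stream_entry_def)
  finally show ?case .
qed (simp add: arrival_time_Suc stream_entry_def)

lemma ennreal_add_le_iff: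
  assumes "0 \<le> x" "0 \<le> t"
  shows "ennreal x + y \<le> ennreal t \<longleftrightarrow> x \<le> t \<and> y \<le> ennreal (t - x)"
proof (cases y)
  case (real r)
  then show ?thesis using assms
    by (auto simp: ennreal_plus[symmetric] ennreal_le_iff simp del: ennreal_plus)
qed (use assms in \<open>auto simp: top_unique\<close>)

lemma stream_renewal_Stream_Suc:
  assumes "0 \<le> x" "0 \<le> t"
  shows "stream_renewal (ennreal x ## \<omega>) t = enat (Suc k) \<longleftrightarrow>
    x \<le> t \<and> stream_renewal \<omega> (t - x) = enat k"
  using assms
  by (auto simp: stream_renewal_def renewal_process_eq_enat_iff arrival_time_Stream
      not_le[symmetric] ennreal_add_le_iff)

lemma stream_renewal_Stream_0:
  assumes "0 \<le> x" "0 \<le> t"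
  shows "stream_renewal (ennreal x ## \<omega>) t = enat 0 \<longleftrightarrow> t < x"
  using assms
  by (auto simp: stream_renewal_def renewal_process_eq_enat_iff arrival_time_Stream ennreal_less_iff)

text \<open>A pathwise fact: nothing happens before the first arrival, so time and the first gap can
  both be cut by \<open>d\<close>. The exponential law enters only when \<open>x\<close> is
  integrated out.\<close>

lemma stream_renewal_memoryless:
  assumes "0 \<le> d" "d \<le> t" "d < x"
  shows "stream_renewal (ennreal x ## \<omega>) t = enat j \<longleftrightarrow>
    stream_renewal (ennreal (x - d) ## \<omega>) (t - d) = enat j"
  using assms
  by (cases j) (auto simp: stream_renewal_Stream_Suc stream_renewal_Stream_0)

lemma measurable_stream_renewal [measurable]:
  assumes [measurable_cong]: "sets E = sets borel"
  shows "Measurable.pred (stream_space E) (\<lambda>\<omega>. stream_renewal \<omega> t = enat k)"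
  unfolding stream_renewal_def renewal_process_eq_enat_iff arrival_time_def stream_entry_def by measurable

lemma measurable_increments_eq:
  assumes "sets E = sets borel"
  shows "Measurable.pred (stream_space E) (\<lambda>\<omega>. increments_eq (stream_renewal \<omega>) s c L)"
proof (induction L arbitrary: s c)
  case (Cons a L)
  then show ?case using measurable_stream_renewal[OF assms] by (cases a) auto
qed simp

lemma nn_integral_exponential_law:
  assumes "0 < \<theta>" and [measurable]: "h \<in> borel_measurable borel"
  shows "(\<integral>\<^sup>+x. h x \<partial>exponential_law \<theta>) =
    (\<integral>\<^sup>+x. ennreal (\<theta> * exp (- \<theta> * x)) * h (ennreal x) * indicator {0<..} x \<partial>lborel)"
proof -
  have "(\<integral>\<^sup>+x. h x \<partial>exponential_law \<theta>) = (\<integral>\<^sup>+x. ennreal (exponential_density \<theta> x) * h (ennreal x) \<partial>lborel)"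
    unfolding erlang_law_def by (simp add: nn_integral_distr nn_integral_density)
  also have "\<dots> = (\<integral>\<^sup>+x. ennreal (\<theta> * exp (- \<theta> * x)) * h (ennreal x) * indicator {0<..} x \<partial>lborel)"
    using AE_lborel_singleton[of "0::real"]
    by (intro nn_integral_cong_AE) (auto elim!: eventually_mono simp: exponential_density_def mult.commute split: split_indicator)
  finally show ?thesis .
qed

section \<open>Joint law of the increments for a stream of exponential gaps\<close>

locale exponential_stream =
  fixes \<theta> :: real
  assumes rate_pos: "0 < \<theta>"
begin

abbreviation "S \<equiv> stream_space (exponential_law \<theta>)"

lemma space_S [simp]: "space S = UNIV"
  by (simp add: space_stream_space)

sublocale E: prob_space "exponential_law \<theta>"
  using rate_pos by (rule prob_space_erlang_law)

sublocale S: prob_space S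
  by (rule E.prob_space_stream_space)

lemma emeasure_S_Stream:
  assumes [measurable]: "Measurable.pred S P"
  shows "emeasure S {\<omega>. P \<omega>} =
    (\<integral>\<^sup>+x. ennreal (\<theta> * exp (- \<theta> * x)) * emeasure S {\<omega>. P (ennreal x ## \<omega>)} * indicator {0<..} x \<partial>lborel)"
proof -
  have [measurable]: "{\<omega>. P \<omega>} \<in> sets S"
    using assms by (simp add: pred_def)
  have "emeasure S {\<omega>. P \<omega>} = (\<integral>\<^sup>+x. emeasure S {\<omega>. P (x ## \<omega>)} \<partial>exponential_law \<theta>)"
    by (subst E.emeasure_stream_space) simp_all
  also have "\<dots> = (\<integral>\<^sup>+x. ennreal (\<theta> * exp (- \<theta> * x)) * emeasure S {\<omega>. P (ennreal x ## \<omega>)} * indicator {0<..} x \<partial>lborel)"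
  proof (rule nn_integral_exponential_law[OF rate_pos])
    have "(\<lambda>x. emeasure S {\<omega>\<in>space S. P (x ## \<omega>)}) \<in> borel_measurable borel"
      by measurable
    then show "(\<lambda>x. emeasure S {\<omega>. P (x ## \<omega>)}) \<in> borel_measurable borel" by simp
  qed
  finally show ?thesis .
qed

text \<open>A first arrival at \<open>x\<close> followed by \<open>k\<close> more in the remaining
  time \<open>d - x\<close>. The exponentials combine to a constant, which leaves a multiple of
  \<open>(d - x) ^ k\<close> with an explicit antiderivative.\<close>

lemma nn_integral_arrival_density:
  assumes "0 \<le> d"
  shows "(\<integral>\<^sup>+x. ennreal (\<theta> * exp (- \<theta> * x) * poisson_mass (\<theta> * (d - x)) k) * indicator {0..d} x \<partial>lborel) =
    ennreal (poisson_mass (\<theta> * d) (Suc k))"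
proof -
  define C where "C = \<theta> ^ Suc k * exp (- \<theta> * d) / fact (Suc k)"
  have "\<theta> * exp (- \<theta> * x) * poisson_mass (\<theta> * (d - x)) k = C * (Suc k * (d - x) ^ k)" for x
  proof -
    have "\<theta> * exp (- \<theta> * x) * poisson_mass (\<theta> * (d - x)) k =
        \<theta> ^ Suc k * (d - x) ^ k * (exp (- \<theta> * x) * exp (- (\<theta> * (d - x)))) / fact k"
      unfolding poisson_mass_def power_mult_distrib by simp
    also have "exp (- \<theta> * x) * exp (- (\<theta> * (d - x))) = exp (- \<theta> * d)"
      by (simp add: mult_exp_exp algebra_simps)
    also have "\<theta> ^ Suc k * (d - x) ^ k * exp (- \<theta> * d) / fact k =
        Suc k * (\<theta> ^ Suc k * (d - x) ^ k * exp (- \<theta> * d)) / (real (Suc k) * fact k)"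
      by (rule mult_divide_mult_cancel_left[symmetric]) simp
    finally show ?thesis by (simp add: C_def mult_ac)
  qed
  then have "(\<integral>\<^sup>+x. ennreal (\<theta> * exp (- \<theta> * x) * poisson_mass (\<theta> * (d - x)) k) * indicator {0..d} x \<partial>lborel) =
    (\<integral>\<^sup>+x. ennreal (C * (Suc k * (d - x) ^ k)) * indicator {0..d} x \<partial>lborel)"
    by (simp only:)
  also have "\<dots> = ennreal (- C * (d - d) ^ Suc k - - C * (d - 0) ^ Suc k)"
  proof (rule nn_integral_FTC_Icc[where F="\<lambda>x. - C * (d - x) ^ Suc k"])
    fix x :: real assume x: "x \<in> {0..d}"
    show "((\<lambda>x. - C * (d - x) ^ Suc k) has_real_derivative C * (Suc k * (d - x) ^ k)) (at x)"
      by (auto intro!: derivative_eq_intros simp del: power_Suc)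
    show "0 \<le> C * (Suc k * (d - x) ^ k)"
      using rate_pos x by (simp add: C_def)
  qed (use assms in auto)
  also have "- C * (d - d) ^ Suc k - - C * (d - 0) ^ Suc k = poisson_mass (\<theta> * d) (Suc k)"
    by (simp add: C_def poisson_mass_def power_mult_distrib)
  finally show ?thesis .
qed

text \<open>Condition on the first arrival: if it comes after time \<open>d\<close>, then by lack of memory the process starts
  afresh at \<open>d\<close> and the first entry \<open>(d, 0)\<close> is removed; if it comes at time \<open>x \<le> d\<close>, then the first entry
  \<open>(d, k + 1)\<close> is replaced by \<open>(d - x, k)\<close>.\<close>

lemma emeasure_increments_eq:
  assumes "list_all (\<lambda>(d, k). 0 \<le> d) L"
  shows "emeasure S {\<omega>. increments_eq (stream_renewal \<omega>) 0 0 L} =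
    ennreal (\<Prod>(d, k)\<leftarrow>L. poisson_mass (\<theta> * d) k)"
  using assms
proof (induction L)
  case Nil
  then show ?case using S.emeasure_space_1 by simp
next
  case (Cons a L)
  obtain d k where a: "a = (d, k)" by force
  define Q where "Q = (\<Prod>(d, k)\<leftarrow>L. poisson_mass (\<theta> * d) k)"
  have L: "list_all (\<lambda>(d, k). 0 \<le> d) L" and "0 \<le> d" using Cons.prems a by auto
  have "0 \<le> Q"
    unfolding Q_def using L rate_pos by (induction L) auto
  have meas: "Measurable.pred S (\<lambda>\<omega>. increments_eq (stream_renewal \<omega>) s c L)" for s c L
    by (rule measurable_increments_eq) simp
  \<comment> \<open>An inner induction on the required increment, inside the one on the list. The
    span \<open>d\<close> varies because a first arrival at \<open>x\<close> leaves
    \<open>d - x\<close>.\<close>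
  have "emeasure S {\<omega>. increments_eq (stream_renewal \<omega>) 0 0 ((d, k) # L)} = ennreal (poisson_mass (\<theta> * d) k * Q)"
    using \<open>0 \<le> d\<close>
  proof (induction k arbitrary: d)
    case 0
    let ?g = "\<lambda>x. emeasure S {\<omega>. increments_eq (stream_renewal (ennreal x ## \<omega>)) 0 0 L}"
    have [measurable]: "?g \<in> borel_measurable borel"
    proof -
      have [measurable]: "{\<omega>. increments_eq (stream_renewal \<omega>) 0 0 L} \<in> sets S"
        using meas[of 0 0 L] by (simp add: pred_def)
      have "(\<lambda>x. emeasure S {\<omega>\<in>space S. ennreal x ## \<omega> \<in> {\<omega>. increments_eq (stream_renewal \<omega>) 0 0 L}}) \<in> borel_measurable borel"
        by measurable
      then show ?thesis by simp
    qed
    have shift: "increments_eq (stream_renewal (ennreal x ## \<omega>)) 0 0 ((d, 0) # L) \<longleftrightarrow>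
        d < x \<and> increments_eq (stream_renewal (ennreal (x - d) ## \<omega>)) 0 0 L" if "0 < x" for x \<omega>
      using that 0 L stream_renewal_memoryless[of d _ x \<omega>]
        increments_eq_shift[of d "stream_renewal (ennreal x ## \<omega>)" 0 "stream_renewal (ennreal (x - d) ## \<omega>)" 0 0 d L 0]
      by (auto simp: stream_renewal_Stream_0)
    have "emeasure S {\<omega>. increments_eq (stream_renewal \<omega>) 0 0 ((d, 0) # L)} =
      (\<integral>\<^sup>+x. ennreal (\<theta> * exp (- \<theta> * x)) * (?g (x - d) * indicator {d<..} x) \<partial>lborel)"
    proof (subst emeasure_S_Stream[OF meas], intro nn_integral_cong)
      fix x
      show "ennreal (\<theta> * exp (- \<theta> * x)) *
          emeasure S {\<omega>. increments_eq (stream_renewal (ennreal x ## \<omega>)) 0 0 ((d, 0) # L)} * indicator {0<..} x =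
        ennreal (\<theta> * exp (- \<theta> * x)) * (?g (x - d) * indicator {d<..} x)"
        using 0 shift[of x] by (cases "0 < x"; cases "d < x") (auto simp del: increments_eq.simps)
    qed
    \<comment> \<open>Substitute \<open>d + x\<close> for \<open>x\<close>. The density then splits
      into \<open>exp (- \<theta> * d)\<close>, the probability of no arrival up to
      \<open>d\<close>, and the density of a fresh first gap.\<close>
    also have "\<dots> = (\<integral>\<^sup>+x. ennreal (\<theta> * exp (- \<theta> * (d + x))) * (?g x * indicator {0<..} x) \<partial>lborel)"
      by (subst nn_integral_real_affine[where c=1 and t=d]) (auto intro!: nn_integral_cong split: split_indicator)
    also have "\<dots> = (\<integral>\<^sup>+x. ennreal (exp (- \<theta> * d)) * (ennreal (\<theta> * exp (- \<theta> * x)) * ?g x * indicator {0<..} x) \<partial>lborel)"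
    proof (intro nn_integral_cong)
      fix x
      have "ennreal (\<theta> * exp (- \<theta> * (d + x))) = ennreal (exp (- \<theta> * d)) * ennreal (\<theta> * exp (- \<theta> * x))"
        using rate_pos by (simp add: ennreal_mult[symmetric] mult_exp_exp algebra_simps)
      then show "ennreal (\<theta> * exp (- \<theta> * (d + x))) * (?g x * indicator {0<..} x) =
        ennreal (exp (- \<theta> * d)) * (ennreal (\<theta> * exp (- \<theta> * x)) * ?g x * indicator {0<..} x)"
        by (simp add: mult.assoc)
    qed
    also have "\<dots> = ennreal (exp (- \<theta> * d)) * emeasure S {\<omega>. increments_eq (stream_renewal \<omega>) 0 0 L}"
      by (subst nn_integral_cmult) (simp_all add: emeasure_S_Stream[OF meas])
    also have "\<dots> = ennreal (poisson_mass (\<theta> * d) 0 * Q)"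
      unfolding Cons.IH[OF L] Q_def[symmetric]
      using \<open>0 \<le> Q\<close> by (simp add: ennreal_mult poisson_mass_def)
    finally show ?case .
  next
    case (Suc k)
    have shift: "increments_eq (stream_renewal (ennreal x ## \<omega>)) 0 0 ((d, Suc k) # L) \<longleftrightarrow>
        x \<le> d \<and> increments_eq (stream_renewal \<omega>) 0 0 ((d - x, k) # L)" if "0 < x" for x \<omega>
      using that Suc.prems L
        increments_eq_shift[of x "stream_renewal (ennreal x ## \<omega>)" 1 "stream_renewal \<omega>" 0 0 d L k]
      by (auto simp: stream_renewal_Stream_Suc)
    have "emeasure S {\<omega>. increments_eq (stream_renewal \<omega>) 0 0 ((d, Suc k) # L)} =
      (\<integral>\<^sup>+x. ennreal (\<theta> * exp (- \<theta> * x) * poisson_mass (\<theta> * (d - x)) k) * indicator {0..d} x * ennreal Q \<partial>lborel)"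
    proof (subst emeasure_S_Stream[OF meas], rule nn_integral_cong_AE)
      show "AE x in lborel. ennreal (\<theta> * exp (- \<theta> * x)) *
          emeasure S {\<omega>. increments_eq (stream_renewal (ennreal x ## \<omega>)) 0 0 ((d, Suc k) # L)} * indicator {0<..} x =
        ennreal (\<theta> * exp (- \<theta> * x) * poisson_mass (\<theta> * (d - x)) k) * indicator {0..d} x * ennreal Q"
        using AE_lborel_singleton[of 0]
      proof eventually_elim
        case (elim x)
        show ?case
        proof (cases "0 < x \<and> x \<le> d")
          case True
          then have "emeasure S {\<omega>. increments_eq (stream_renewal (ennreal x ## \<omega>)) 0 0 ((d, Suc k) # L)} =
            ennreal (poisson_mass (\<theta> * (d - x)) k * Q)"
            using shift[of x] Suc.IH[of "d - x"] by (simp del: increments_eq.simps)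
          then show ?thesis
            using True rate_pos \<open>0 \<le> Q\<close> by (simp add: ennreal_mult mult.assoc)
        next
          case False
          then show ?thesis using elim shift[of x] by (cases "0 < x") (auto simp del: increments_eq.simps)
        qed
      qed
    qed
    also have "\<dots> = ennreal (poisson_mass (\<theta> * d) (Suc k)) * ennreal Q"
      by (subst nn_integral_multc) (simp_all only: nn_integral_arrival_density[OF Suc.prems], simp add: poisson_mass_def)
    also have "\<dots> = ennreal (poisson_mass (\<theta> * d) (Suc k) * Q)"
      using \<open>0 \<le> Q\<close> Suc.prems rate_pos by (simp add: ennreal_mult)
    finally show ?case .
  qed
  then show ?case by (simp add: a Q_def)
qed

end

text \<open>From a finite level on, increments and levels determine each other. Monotonicity matters
  since subtraction in \<open>enat\<close> is truncated: a decrease would pass for an increment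
  0.\<close>

lemma increments_eq_iff_increments:
  fixes N :: "real \<Rightarrow> 'b \<Rightarrow> enat"
  assumes "mono (\<lambda>t. N t \<omega>)" and u: "\<And>i. i < n \<Longrightarrow> u i \<le> u (Suc i)" and "m \<le> n" and "N (u m) \<omega> = enat c"
  shows "increments_eq (\<lambda>t. N t \<omega>) (u m) c (map (\<lambda>i. (u (Suc i) - u i, k i)) [m..<n]) \<longleftrightarrow>
    (\<forall>i\<in>{m..<n}. increment N (u i) (u (Suc i)) \<omega> = enat (k i))"
  using assms(3,4)
proof (induction m arbitrary: c rule: inc_induct)
  case (step m)
  have "N (u m) \<omega> \<le> N (u (Suc m)) \<omega>"
    using monoD[OF assms(1)] u step.hyps by simp
  then have *: "increment N (u m) (u (Suc m)) \<omega> = enat (k m) \<longleftrightarrow> N (u (Suc m)) \<omega> = enat (c + k m)"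
    using step.prems by (cases "N (u (Suc m)) \<omega>") (auto simp: increment_def)
  have split: "{m..<n} = insert m {Suc m..<n}" using step.hyps by auto
  show ?case
    using step.IH[of "c + k m"] step.hyps * by (auto simp: upt_conv_Cons split)
qed simp

section \<open>Random variables as random streams, and independence through point masses\<close>

lemma renewal_process_eq_stream_renewal:
  "renewal_process T t \<omega> = stream_renewal (to_stream (\<lambda>i. T (Suc i) \<omega>)) t"
proof -
  have "arrival_time T n \<omega> = arrival_time stream_entry n (to_stream (\<lambda>i. T (Suc i) \<omega>))" for n
    unfolding arrival_time_def by (intro sum.cong) (auto simp: stream_entry_def to_stream_def)
  then show ?thesis by (simp add: renewal_process_def stream_renewal_def)
qed

context prob_space
begin

text \<open>Independence makes the joint law a product over \<open>{1..}\<close>; reindexing by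
  \<open>Suc\<close> carries it to the product over all natural numbers, whose image under
  \<open>to_stream\<close> is the stream law.\<close>

lemma distr_to_stream_iid:
  assumes indep: "indep_vars (\<lambda>_. borel) T {1..}" and law: "\<And>i. 1 \<le> i \<Longrightarrow> distr M borel (T i) = E"
    and "prob_space E" and [measurable_cong]: "sets E = sets borel"
  shows "(\<lambda>\<omega>. to_stream (\<lambda>i. T (Suc i) \<omega>)) \<in> measurable M (stream_space E)"
    and "distr M (stream_space E) (\<lambda>\<omega>. to_stream (\<lambda>i. T (Suc i) \<omega>)) = stream_space E"
proof -
  interpret E: prob_space E by fact
  have [measurable]: "T i \<in> borel_measurable M" if "1 \<le> i" for i
    using indep that by (simp add: indep_vars_def)
  have T_Suc [measurable]: "T (Suc i) \<in> borel_measurable M" for i by simp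
  show "(\<lambda>\<omega>. to_stream (\<lambda>i. T (Suc i) \<omega>)) \<in> measurable M (stream_space E)"
    by (rule measurable_stream_space2) (simp add: to_stream_def)
  have T_meas [measurable]: "(\<lambda>\<omega>. \<lambda>i\<in>{1..}. T i \<omega>) \<in> measurable M (\<Pi>\<^sub>M i\<in>{1..}. E)"
    by (intro measurable_restrict) simp
  have shift [measurable]: "(\<lambda>\<tau>. \<lambda>n\<in>UNIV. \<tau> (Suc n)) \<in> measurable (\<Pi>\<^sub>M i\<in>{1..}. E) (\<Pi>\<^sub>M i\<in>UNIV. E)"
    by (intro measurable_restrict measurable_component_singleton) auto
  have stream_shift: "(\<lambda>\<tau>. to_stream (\<lambda>n. \<tau> (Suc n))) \<in> measurable (\<Pi>\<^sub>M i\<in>{1..}. E) (stream_space E)"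
    using measurable_comp[OF shift measurable_to_stream] by (simp add: comp_def restrict_UNIV)
  have "distr M (\<Pi>\<^sub>M i\<in>{1..}. E) (\<lambda>\<omega>. \<lambda>i\<in>{1..}. T i \<omega>) =
      distr M (\<Pi>\<^sub>M i\<in>{1..}. borel) (\<lambda>\<omega>. \<lambda>i\<in>{1..}. T i \<omega>)"
    by (intro distr_cong sets_PiM_cong) (auto simp: assms)
  also have "\<dots> = (\<Pi>\<^sub>M i\<in>{1..}. distr M borel (T i))"
    using indep by (subst (asm) indep_vars_iff_distr_eq_PiM') auto
  also have "\<dots> = (\<Pi>\<^sub>M i\<in>{1..}. E)"
    by (intro PiM_cong) (auto simp: law)
  finally have joint: "distr M (\<Pi>\<^sub>M i\<in>{1..}. E) (\<lambda>\<omega>. \<lambda>i\<in>{1..}. T i \<omega>) = (\<Pi>\<^sub>M i\<in>{1..}. E)" .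
  have "stream_space E = distr (\<Pi>\<^sub>M i\<in>UNIV. E) (stream_space E) to_stream"
    by (rule stream_space_eq_distr)
  also have "(\<Pi>\<^sub>M i\<in>(UNIV::nat set). E) = distr (\<Pi>\<^sub>M i\<in>{1..}. E) (\<Pi>\<^sub>M i\<in>UNIV. E) (\<lambda>\<tau>. \<lambda>n\<in>UNIV. \<tau> (Suc n))"
    by (rule distr_PiM_reindex[symmetric]) (auto intro: E.prob_space_axioms)
  also have "distr \<dots> (stream_space E) to_stream =
      distr (\<Pi>\<^sub>M i\<in>{1..}. E) (stream_space E) (\<lambda>\<tau>. to_stream (\<lambda>n. \<tau> (Suc n)))"
    by (subst distr_distr) (simp_all add: comp_def restrict_UNIV shift[unfolded restrict_UNIV, simplified])
  also have "\<dots> = distr (distr M (\<Pi>\<^sub>M i\<in>{1..}. E) (\<lambda>\<omega>. \<lambda>i\<in>{1..}. T i \<omega>)) (stream_space E) (\<lambda>\<tau>. to_stream (\<lambda>n. \<tau> (Suc n)))"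
    by (simp only: joint)
  also have "\<dots> = distr M (stream_space E) (\<lambda>\<omega>. to_stream (\<lambda>i. T (Suc i) \<omega>))"
    by (subst distr_distr[OF stream_shift T_meas]) (simp add: comp_def)
  finally show "distr M (stream_space E) (\<lambda>\<omega>. to_stream (\<lambda>i. T (Suc i) \<omega>)) = stream_space E" ..
qed

lemma measurable_renewal_process:
  assumes "\<And>i. 1 \<le> i \<Longrightarrow> T i \<in> borel_measurable M"
  shows "renewal_process T t \<in> measurable M (count_space UNIV)"
proof (rule measurable_count_space_eq_countable[THEN iffD2], safe)
  have [measurable]: "arrival_time T n \<in> borel_measurable M" for n
    unfolding arrival_time_def[abs_def] using assms by (intro borel_measurable_sum) auto
  fix y :: enat
  have fin: "renewal_process T t -` {enat k} \<inter> space M \<in> sets M" for k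
  proof -
    have "renewal_process T t -` {enat k} \<inter> space M =
      {\<omega>\<in>space M. arrival_time T k \<omega> \<le> ennreal t \<and> ennreal t < arrival_time T (Suc k) \<omega>}"
      by (auto simp: renewal_process_eq_enat_iff)
    then show ?thesis by simp
  qed
  show "renewal_process T t -` {y} \<inter> space M \<in> sets M"
  proof (cases y)
    case infinity
    have inf_iff: "z = \<infinity> \<longleftrightarrow> (\<forall>k. enat k \<le> z)" for z
      by (cases z) (auto, metis Suc_n_not_le_n)
    have "renewal_process T t -` {y} \<inter> space M = {\<omega>\<in>space M. \<forall>k. arrival_time T k \<omega> \<le> ennreal t}"
      using infinity inf_iff[of "renewal_process T t _"] by (auto simp: enat_le_renewal_process_iff)
    then show ?thesis by simp
  qed (simp add: fin)
qed simp_all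

text \<open>The joint law lives on a countable space, so point masses determine it. Points with
  finite coordinates are covered by \<open>masses\<close>; with an infinite coordinate both sides
  vanish.\<close>

lemma indep_vars_enat_if_masses:
  fixes Y :: "nat \<Rightarrow> 'a \<Rightarrow> enat"
  assumes meas: "\<And>i. i < n \<Longrightarrow> Y i \<in> measurable M (count_space UNIV)"
    and fin: "\<And>i. i < n \<Longrightarrow> AE \<omega> in M. Y i \<omega> < \<infinity>"
    and masses: "\<And>k. prob {\<omega>\<in>space M. \<forall>i<n. Y i \<omega> = enat (k i)} =
      (\<Prod>i<n. prob {\<omega>\<in>space M. Y i \<omega> = enat (k i)})"
  shows "indep_vars (\<lambda>_. count_space UNIV) Y {..<n}"
proof (cases "n = 0")
  case True
  then show ?thesis by (simp add: indep_vars_def indep_sets_def)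
next
  case False
  let ?C = "count_space UNIV :: enat measure"
  have PiM_eq: "(\<Pi>\<^sub>M i\<in>{..<n}. ?C) = count_space (PiE {..<n} (\<lambda>_. UNIV))"
    by (rule count_space_PiM_finite) auto
  have vec [measurable]: "(\<lambda>\<omega>. \<lambda>i\<in>{..<n}. Y i \<omega>) \<in> measurable M (\<Pi>\<^sub>M i\<in>{..<n}. ?C)"
    using meas by (intro measurable_restrict) auto
  \<comment> \<open>The filler at \<open>i \<ge> n\<close> makes every \<open>D i\<close> a
    probability measure, as the locale of product measures demands.\<close>
  define D where "D i = (if i < n then distr M ?C (Y i) else return ?C 0)" for i
  have D: "prob_space (D i)" for i
    using meas[of i] by (auto simp: D_def intro!: prob_space_distr prob_space_return)
  interpret D: product_prob_space D "{..<n}"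
    by (simp add: product_prob_space_def product_prob_space_axioms_def product_sigma_finite_def D prob_space_imp_sigma_finite)
  have sets_D: "sets (D i) = UNIV" for i by (auto simp: D_def)
  have "distr M (\<Pi>\<^sub>M i\<in>{..<n}. ?C) (\<lambda>\<omega>. \<lambda>i\<in>{..<n}. Y i \<omega>) = (\<Pi>\<^sub>M i\<in>{..<n}. D i)"
  proof (rule measure_eqI_countable)
    show "sets (distr M (\<Pi>\<^sub>M i\<in>{..<n}. ?C) (\<lambda>\<omega>. \<lambda>i\<in>{..<n}. Y i \<omega>)) = Pow (PiE {..<n} (\<lambda>_. UNIV))"
      by (simp add: PiM_eq)
    have "sets (\<Pi>\<^sub>M i\<in>{..<n}. D i) = sets (\<Pi>\<^sub>M i\<in>{..<n}. ?C)"
      by (intro sets_PiM_cong) (auto simp: sets_D)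
    then show "sets (\<Pi>\<^sub>M i\<in>{..<n}. D i) = Pow (PiE {..<n} (\<lambda>_. UNIV))"
      by (simp add: PiM_eq)
    show "countable (PiE {..<n} (\<lambda>_. UNIV :: enat set))"
      by (intro countable_PiE) auto
    fix a :: "nat \<Rightarrow> enat" assume a: "a \<in> PiE {..<n} (\<lambda>_. UNIV)"
    have "emeasure (\<Pi>\<^sub>M i\<in>{..<n}. D i) {a} = emeasure (\<Pi>\<^sub>M i\<in>{..<n}. D i) (PiE {..<n} (\<lambda>i. {a i}))"
      using a by (subst PiE_singleton) (auto simp: PiE_def)
    also have "\<dots> = (\<Prod>i<n. emeasure (D i) {a i})"
      by (rule D.emeasure_PiM) (auto simp: sets_D)
    also have "\<dots> = (\<Prod>i<n. ennreal (prob {\<omega>\<in>space M. Y i \<omega> = a i}))"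
    proof (intro prod.cong refl)
      fix i assume i: "i \<in> {..<n}"
      then have "emeasure (D i) {a i} = emeasure M (Y i -` {a i} \<inter> space M)"
        using meas[of i] by (simp add: D_def emeasure_distr)
      also have "Y i -` {a i} \<inter> space M = {\<omega>\<in>space M. Y i \<omega> = a i}" by auto
      finally show "emeasure (D i) {a i} = ennreal (prob {\<omega>\<in>space M. Y i \<omega> = a i})"
        by (simp add: emeasure_eq_measure)
    qed
    also have "\<dots> = ennreal (\<Prod>i<n. prob {\<omega>\<in>space M. Y i \<omega> = a i})"
      by (simp add: prod_ennreal)
    also have "(\<Prod>i<n. prob {\<omega>\<in>space M. Y i \<omega> = a i}) = prob {\<omega>\<in>space M. \<forall>i<n. Y i \<omega> = a i}"
    proof (cases "\<forall>i<n. a i \<noteq> \<infinity>")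
      case True
      then have k: "a i = enat (the_enat (a i))" if "i < n" for i
        using that by (cases "a i") auto
      have "(\<forall>i<n. Y i \<omega> = a i) \<longleftrightarrow> (\<forall>i<n. Y i \<omega> = enat (the_enat (a i)))" for \<omega>
        using k by metis
      moreover have "(\<Prod>i<n. prob {\<omega>\<in>space M. Y i \<omega> = a i}) =
          (\<Prod>i<n. prob {\<omega>\<in>space M. Y i \<omega> = enat (the_enat (a i))})"
        by (intro prod.cong) (use k in \<open>metis lessThan_iff\<close>)+
      ultimately show ?thesis by (simp only: masses)
    next
      case False
      then obtain j where j: "j < n" "a j = \<infinity>" by auto
      have AE_j: "AE \<omega> in M. Y j \<omega> \<noteq> \<infinity>" using fin[OF j(1)] by eventually_elim auto
      have 0: "prob {\<omega>\<in>space M. P \<omega>} = 0" if "\<And>\<omega>. P \<omega> \<Longrightarrow> Y j \<omega> = \<infinity>" for P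
      proof (cases "{\<omega>\<in>space M. P \<omega>} \<in> sets M")
        case True
        have "AE \<omega> in M. \<omega> \<notin> {\<omega>\<in>space M. P \<omega>}" using AE_j by eventually_elim (auto dest: that)
        then show ?thesis using prob_eq_0[OF True] by blast
      qed (simp add: measure_notin_sets)
      have "prob {\<omega>\<in>space M. Y j \<omega> = a j} = 0"
        by (rule 0) (simp add: j)
      then have "(\<Prod>i<n. prob {\<omega>\<in>space M. Y i \<omega> = a i}) = 0"
        using j(1) by (intro prod_zero) blast+
      moreover have "prob {\<omega>\<in>space M. \<forall>i<n. Y i \<omega> = a i} = 0"
        by (rule 0) (metis j)
      ultimately show ?thesis by (rule trans[OF _ sym])
    qed
    also have "ennreal \<dots> = emeasure M {\<omega>\<in>space M. \<forall>i<n. Y i \<omega> = a i}"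
      by (simp add: emeasure_eq_measure)
    also have "{\<omega>\<in>space M. \<forall>i<n. Y i \<omega> = a i} = (\<lambda>\<omega>. \<lambda>i\<in>{..<n}. Y i \<omega>) -` {a} \<inter> space M"
    proof -
      have *: "restrict f {..<n} = a \<longleftrightarrow> (\<forall>i<n. f i = a i)" for f
      proof
        assume "\<forall>i<n. f i = a i"
        then show "restrict f {..<n} = a"
          using a by (intro extensionalityI[of _ "{..<n}"]) (auto simp: PiE_def)
      qed auto
      show ?thesis
        unfolding vimage_def singleton_iff * by (simp only: Int_def mem_Collect_eq conj_commute)
    qed
    also have "emeasure M \<dots> = emeasure (distr M (\<Pi>\<^sub>M i\<in>{..<n}. ?C) (\<lambda>\<omega>. \<lambda>i\<in>{..<n}. Y i \<omega>)) {a}"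
    proof (rule emeasure_distr[OF vec, symmetric])
      show "{a} \<in> sets (\<Pi>\<^sub>M i\<in>{..<n}. ?C)"
        using a unfolding PiM_eq by simp
    qed
    finally show "emeasure (distr M (\<Pi>\<^sub>M i\<in>{..<n}. ?C) (\<lambda>\<omega>. \<lambda>i\<in>{..<n}. Y i \<omega>)) {a} =
      emeasure (\<Pi>\<^sub>M i\<in>{..<n}. D i) {a}" ..
  qed
  also have "(\<Pi>\<^sub>M i\<in>{..<n}. D i) = (\<Pi>\<^sub>M i\<in>{..<n}. distr M ?C (Y i))"
    by (intro PiM_cong) (auto simp: D_def)
  finally show ?thesis
    using False meas by (subst indep_vars_iff_distr_eq_PiM') auto
qed

end

lemma increment_if_start_0: "N s \<omega> = 0 \<Longrightarrow> increment N s t \<omega> = N t \<omega>"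
  by (cases "N t \<omega>") (auto simp: increment_def zero_enat_def)

lemma measurable_increment:
  assumes "N s \<in> measurable M (count_space UNIV)" "N t \<in> measurable M (count_space UNIV)"
  shows "increment N s t \<in> measurable M (count_space UNIV)"
proof -
  have "(\<lambda>\<omega>. (\<lambda>a \<omega>. if a < \<infinity> then N t \<omega> - a else 0) (N s \<omega>) \<omega>) \<in> measurable M (count_space UNIV)"
  proof (rule measurable_compose_countable[OF _ assms(1)])
    fix a :: enat
    show "(\<lambda>\<omega>. if a < \<infinity> then N t \<omega> - a else 0) \<in> measurable M (count_space UNIV)"
      by (rule measurable_compose[OF assms(2)]) simp
  qed
  then show ?thesis by (simp add: increment_def[abs_def])
qed

lemma emeasure_Pois_singleton: "emeasure (Pois r) {k} = ennreal (poisson_mass r k)"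
  unfolding Pois_def poisson_mass_def by (simp add: emeasure_density nn_integral_count_space_indicator[symmetric])

lemma emeasure_distr_Pois:
  "emeasure (distr (Pois r) (count_space UNIV) enat) {y} =
    (case y of enat k \<Rightarrow> ennreal (poisson_mass r k) | \<infinity> \<Rightarrow> 0)"
proof -
  have [measurable]: "enat \<in> measurable (Pois r) (count_space UNIV)"
    by (simp add: Pois_def)
  have "enat -` {enat k} = {k}" for k by auto
  moreover have "enat -` {\<infinity>} = {}" by auto
  moreover have "space (Pois r) = UNIV" by (simp add: Pois_def)
  ultimately show ?thesis
    by (cases y) (simp_all add: emeasure_distr emeasure_Pois_singleton)
qed

section \<open>The renewal process with exponential gaps is Poisson\<close>

locale exponential_renewal = prob_space M + exponential_stream \<theta> for M :: "'a measure" and \<theta> +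
  fixes T :: "nat \<Rightarrow> 'a \<Rightarrow> ennreal"
  assumes indep: "indep_vars (\<lambda>_. borel) T {1..}"
    and law: "1 \<le> i \<Longrightarrow> distr M borel (T i) = exponential_law \<theta>"
begin

abbreviation "N \<equiv> renewal_process T"

lemma T_measurable: "1 \<le> i \<Longrightarrow> T i \<in> borel_measurable M"
  using indep by (simp add: indep_vars_def)

lemma N_measurable [measurable]: "N t \<in> measurable M (count_space UNIV)"
  by (rule measurable_renewal_process[OF T_measurable])

lemma increments_eq_measurable: "{\<omega>\<in>space M. increments_eq (\<lambda>t. N t \<omega>) s c L} \<in> sets M"
proof (induction L arbitrary: s c)
  case (Cons a L)
  obtain d k where a: "a = (d, k)" by force
  have "{\<omega>\<in>space M. increments_eq (\<lambda>t. N t \<omega>) s c (a # L)} =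
    {\<omega>\<in>space M. N (s + d) \<omega> = enat (c + k)} \<inter> {\<omega>\<in>space M. increments_eq (\<lambda>t. N t \<omega>) (s + d) (c + k) L}"
    by (auto simp: a)
  also have "\<dots> \<in> sets M" by (intro sets.Int Cons.IH) measurable
  finally show ?case .
qed simp

lemma emeasure_increments_eq_N:
  assumes "list_all (\<lambda>(d, k). 0 \<le> d) L"
  shows "emeasure M {\<omega>\<in>space M. increments_eq (\<lambda>t. N t \<omega>) 0 0 L} =
    ennreal (\<Prod>(d, k)\<leftarrow>L. poisson_mass (\<theta> * d) k)"
proof -
  let ?str = "\<lambda>\<omega>. to_stream (\<lambda>i. T (Suc i) \<omega>)"
  have str: "?str \<in> measurable M S" "distr M S ?str = S"
    using distr_to_stream_iid[OF indep law E.prob_space_axioms sets_erlang_law] by auto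
  have sets: "{\<tau>. increments_eq (stream_renewal \<tau>) 0 0 L} \<in> sets S"
    using measurable_increments_eq[of "exponential_law \<theta>" 0 0 L] by (simp add: pred_def)
  have "{\<omega>\<in>space M. increments_eq (\<lambda>t. N t \<omega>) 0 0 L} =
      ?str -` {\<tau>. increments_eq (stream_renewal \<tau>) 0 0 L} \<inter> space M"
    by (auto simp: renewal_process_eq_stream_renewal)
  then have "emeasure M {\<omega>\<in>space M. increments_eq (\<lambda>t. N t \<omega>) 0 0 L} =
      emeasure (distr M S ?str) {\<tau>. increments_eq (stream_renewal \<tau>) 0 0 L}"
    using emeasure_distr[OF str(1) sets] by simp
  then show ?thesis
    unfolding str(2) using emeasure_increments_eq[OF assms] by simp
qed

lemma emeasure_N_eq:
  assumes "0 \<le> t"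
  shows "emeasure M {\<omega>\<in>space M. N t \<omega> = enat k} = ennreal (poisson_mass (\<theta> * t) k)"
  using emeasure_increments_eq_N[of "[(t, k)]"] assms by simp

text \<open>The masses of the finite levels already add up to 1, so nothing is left for
  infinity.\<close>

lemma AE_N_finite_at:
  assumes "0 \<le> t"
  shows "AE \<omega> in M. N t \<omega> < \<infinity>"
proof -
  let ?A = "\<lambda>k. {\<omega>\<in>space M. N t \<omega> = enat k}"
  have "emeasure M (\<Union>k. ?A k) = (\<Sum>k. emeasure M (?A k))"
    by (intro suminf_emeasure[symmetric]) (auto simp: disjoint_family_on_def)
  also have "\<dots> = (\<Sum>k. ennreal (poisson_mass (\<theta> * t) k))"
    using emeasure_N_eq[OF assms] by simp
  also have "\<dots> = ennreal 1"
    using poisson_mass_sums[of "\<theta> * t"] rate_pos assms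
    by (subst suminf_ennreal2) (auto simp: sums_iff)
  finally have "prob (\<Union>k. ?A k) = 1"
    by (simp add: measure_def)
  then have "AE \<omega> in M. \<omega> \<in> (\<Union>k. ?A k)"
    by (subst (asm) prob_eq_1) auto
  then show ?thesis by eventually_elim auto
qed

lemma AE_N_finite: "AE \<omega> in M. \<forall>t\<ge>0. N t \<omega> < \<infinity>"
proof -
  \<comment> \<open>Monotone paths reduce the uncountably many times to the natural numbers.\<close>
  have "AE \<omega> in M. \<forall>n::nat. N (real n) \<omega> < \<infinity>"
    unfolding AE_all_countable by (intro allI AE_N_finite_at) simp
  then show ?thesis
  proof eventually_elim
    case (elim \<omega>)
    show ?case
    proof (intro allI impI)
      fix t :: real
      obtain n :: nat where "t \<le> real n" using real_arch_simple by blast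
      then have "N t \<omega> \<le> N (real n) \<omega>" by (rule renewal_process_mono)
      also have "\<dots> < \<infinity>" using elim by blast
      finally show "N t \<omega> < \<infinity>" .
    qed
  qed
qed

text \<open>\<open>increments_eq\<close> is evaluated from time 0 and level 0. So an entry
  \<open>(u 0, c)\<close> is prepended for each possible level \<open>c\<close> at time
  \<open>u 0\<close>, and summing over \<open>c\<close> removes it because Poisson masses add up to
  1.\<close>

lemma prob_increments:
  assumes "0 \<le> u 0" and u: "\<And>i. i < n \<Longrightarrow> u i \<le> u (Suc i)"
  shows "prob {\<omega>\<in>space M. \<forall>i<n. increment N (u i) (u (Suc i)) \<omega> = enat (k i)} =
    (\<Prod>i<n. poisson_mass (\<theta> * (u (Suc i) - u i)) (k i))"
proof -
  define L where "L = map (\<lambda>i. (u (Suc i) - u i, k i)) [0..<n]"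
  define Q where "Q = (\<Prod>i<n. poisson_mass (\<theta> * (u (Suc i) - u i)) (k i))"
  have "Q \<ge> 0" unfolding Q_def using u rate_pos by (intro prod_nonneg) auto
  have L: "list_all (\<lambda>(d, k). 0 \<le> d) ((u 0, c) # L)" for c
    using assms by (auto simp: L_def list_all_iff)
  have Q_L: "(\<Prod>(d, k)\<leftarrow>L. poisson_mass (\<theta> * d) k) = Q"
    unfolding L_def Q_def by (simp add: comp_def interv_sum_list_conv_sum_set_nat prod.distinct_set_conv_list[symmetric] atLeast0LessThan)
  define A where "A c = {\<omega>\<in>space M. increments_eq (\<lambda>t. N t \<omega>) 0 0 ((u 0, c) # L)}" for c
  define B where "B = {\<omega>\<in>space M. \<forall>i<n. increment N (u i) (u (Suc i)) \<omega> = enat (k i)}"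
  have A_sets [measurable]: "A c \<in> sets M" for c
    unfolding A_def by (rule increments_eq_measurable)
  have B_sets [measurable]: "B \<in> sets M"
  proof -
    have [measurable]: "increment N s t \<in> measurable M (count_space UNIV)" for s t
      by (rule measurable_increment) simp_all
    show ?thesis unfolding B_def by measurable
  qed
  have A_eq: "\<omega> \<in> A c \<longleftrightarrow> \<omega> \<in> B \<and> N (u 0) \<omega> = enat c" for \<omega> c
    using increments_eq_iff_increments[of N \<omega> n u 0 c k] u
    by (auto simp: A_def B_def L_def mono_def renewal_process_mono)
  have "emeasure M B = emeasure M (\<Union>c. A c)"
  proof (rule emeasure_eq_AE)
    show "AE \<omega> in M. \<omega> \<in> B \<longleftrightarrow> \<omega> \<in> (\<Union>c. A c)"
      using AE_N_finite_at[OF assms(1)] by eventually_elim (auto simp: A_eq)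
  qed auto
  also have "\<dots> = (\<Sum>c. emeasure M (A c))"
    by (intro suminf_emeasure[symmetric]) (auto simp: disjoint_family_on_def A_eq)
  also have "\<dots> = (\<Sum>c. ennreal (poisson_mass (\<theta> * u 0) c * Q))"
    unfolding A_def using emeasure_increments_eq_N[OF L] by (simp add: Q_L)
  also have "\<dots> = ennreal (1 * Q)"
  proof -
    have "(\<lambda>c. poisson_mass (\<theta> * u 0) c * Q) sums (1 * Q)"
      by (intro sums_mult2 poisson_mass_sums)
    then show ?thesis
      using \<open>Q \<ge> 0\<close> rate_pos assms(1) by (subst suminf_ennreal2) (auto simp: sums_iff)
  qed
  finally show ?thesis
    using \<open>Q \<ge> 0\<close> by (simp add: B_def Q_def measure_def)
qed

lemma emeasure_increment_eq:
  assumes "0 \<le> s" "s \<le> t"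
  shows "emeasure M {\<omega>\<in>space M. increment N s t \<omega> = enat k} = ennreal (poisson_mass (\<theta> * (t - s)) k)"
  using prob_increments[of "\<lambda>i. if i = 0 then s else t" 1 "\<lambda>_. k"] assms
  by (simp add: emeasure_eq_measure)

lemma AE_increment_finite:
  assumes "0 \<le> s" "s \<le> t"
  shows "AE \<omega> in M. increment N s t \<omega> < \<infinity>"
  using AE_N_finite
proof eventually_elim
  case (elim \<omega>)
  then have "N s \<omega> < \<infinity>" "N t \<omega> < \<infinity>" using assms by auto
  then show ?case by (auto simp: increment_def)
qed

lemma AE_T_pos: "AE \<omega> in M. \<forall>i\<ge>1. 0 < T i \<omega>"
proof (subst AE_all_countable, intro allI AE_impI)
  fix i :: nat assume i: "1 \<le> i"
  have "AE x in exponential_law \<theta>. 0 < x"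
    unfolding erlang_law_def
    using AE_lborel_singleton[of "0::real"]
    by (auto simp: AE_distr_iff AE_density erlang_density_def elim!: eventually_mono)
  then show "AE \<omega> in M. 0 < T i \<omega>"
    unfolding law[OF i, symmetric] using T_measurable[OF i] by (simp add: AE_distr_iff)
qed

lemma HPP_renewal_process: "HPP M \<theta> N"
  unfolding HPP_def
proof (intro conjI)
  show "counting_process M N"
    unfolding counting_process_def
    by (auto intro!: mono_onI renewal_process_mono renewal_process_right_continuous)
  show "AE \<omega> in M. \<forall>t\<ge>0. N t \<omega> < \<infinity>" by (rule AE_N_finite)
  show "AE \<omega> in M. \<forall>t>0. let L = Lim (at_left t) (\<lambda>s. N s \<omega>) in N t \<omega> = L \<or> N t \<omega> = L + 1"
    using AE_N_finite AE_T_pos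
  proof eventually_elim
    case (elim \<omega>)
    then show ?case by (intro allI impI renewal_process_left_jump) auto
  qed
  show "AE \<omega> in M. N 0 \<omega> = 0"
    using AE_T_pos
  proof eventually_elim
    case (elim \<omega>)
    then show ?case
      using renewal_process_eq_enat_iff[of T 0 \<omega> 0] by (simp add: arrival_time_Suc zero_enat_def)
  qed
  show "independent_increments M N"
    unfolding independent_increments_def
  proof (intro allI impI)
    fix n :: nat and u :: "nat \<Rightarrow> real"
    assume u: "0 \<le> u 0 \<and> (\<forall>i<n. u i \<le> u (Suc i))"
    have u_nonneg: "0 \<le> u i" if "i \<le> n" for i
      using that u by (induction i) (auto intro: order_trans)
    show "indep_vars (\<lambda>_. count_space UNIV) (\<lambda>i. increment N (u i) (u (Suc i))) {..<n}"
    proof (rule indep_vars_enat_if_masses)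
      fix i assume "i < n"
      then show "AE \<omega> in M. increment N (u i) (u (Suc i)) \<omega> < \<infinity>"
        using u u_nonneg by (intro AE_increment_finite) auto
    next
      fix k :: "nat \<Rightarrow> nat"
      have "prob {\<omega>\<in>space M. increment N (u i) (u (Suc i)) \<omega> = enat (k i)} =
        poisson_mass (\<theta> * (u (Suc i) - u i)) (k i)" if "i < n" for i
        using emeasure_increment_eq[of "u i" "u (Suc i)" "k i"] that u u_nonneg[of i] rate_pos
        by (simp add: measure_def)
      then show "prob {\<omega>\<in>space M. \<forall>i<n. increment N (u i) (u (Suc i)) \<omega> = enat (k i)} =
        (\<Prod>i<n. prob {\<omega>\<in>space M. increment N (u i) (u (Suc i)) \<omega> = enat (k i)})"
        using prob_increments[of u n k] u by simp
    qed (rule measurable_increment, simp_all)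
  qed
  show "\<forall>s t. 0 \<le> s \<and> s \<le> t \<longrightarrow> distr M (count_space UNIV) (increment N s t) =
    distr (Pois (\<theta> * (t - s))) (count_space UNIV) enat"
  proof (intro allI impI)
    fix s t :: real assume st: "0 \<le> s \<and> s \<le> t"
    have inc: "increment N s t \<in> measurable M (count_space UNIV)"
      by (rule measurable_increment) simp_all
    show "distr M (count_space UNIV) (increment N s t) = distr (Pois (\<theta> * (t - s))) (count_space UNIV) enat"
    proof (rule measure_eqI_countable)
      fix y :: enat
      have "emeasure (distr M (count_space UNIV) (increment N s t)) {y} = emeasure M {\<omega>\<in>space M. increment N s t \<omega> = y}"
        by (subst emeasure_distr[OF inc]) (auto intro!: arg_cong[where f="emeasure M"])
      also have "\<dots> = (case y of enat k \<Rightarrow> ennreal (poisson_mass (\<theta> * (t - s)) k) | \<infinity> \<Rightarrow> 0)"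
      proof (cases y)
        case (enat k)
        then show ?thesis using st by (simp add: emeasure_increment_eq)
      next
        case infinity
        have "AE \<omega> in M. increment N s t \<omega> < \<infinity>"
          using st by (intro AE_increment_finite) auto
        then have "AE \<omega> in M. \<not> increment N s t \<omega> = y"
          by eventually_elim (auto simp: infinity)
        then have "emeasure M {\<omega>\<in>space M. increment N s t \<omega> = y} = 0"
          using inc by (subst (asm) AE_iff_measurable[OF _ refl]) auto
        then show ?thesis by (simp add: infinity)
      qed
      finally show "emeasure (distr M (count_space UNIV) (increment N s t)) {y} =
          emeasure (distr (Pois (\<theta> * (t - s))) (count_space UNIV) enat) {y}"
        by (simp add: emeasure_distr_Pois)
    qed auto
  qed
qed

end

subsection \<open>Laplace transforms and the Poisson property\<close>

context prob_space
begin

lemma expectation_prod_exp_neg: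
  assumes "indep_vars (\<lambda>_. borel) T J" "finite I" "I \<subseteq> J"
  shows "expectation (\<lambda>\<omega>. \<Prod>i\<in>I. exp_neg (T i \<omega>) ^ e i) = (\<Prod>i\<in>I. laplace (distr M borel (T i)) (e i))"
proof -
  have T: "T i \<in> borel_measurable M" if "i \<in> I" for i
    using assms that by (auto simp: indep_vars_def)
  have "indep_vars (\<lambda>_. borel) (\<lambda>i \<omega>. exp_neg (T i \<omega>) ^ e i) I"
    by (rule indep_vars_compose2[OF indep_vars_subset[OF assms(1,3)]]) simp
  then have "expectation (\<lambda>\<omega>. \<Prod>i\<in>I. exp_neg (T i \<omega>) ^ e i) = (\<Prod>i\<in>I. expectation (\<lambda>\<omega>. exp_neg (T i \<omega>) ^ e i))"
  proof (rule indep_vars_lebesgue_integral[OF assms(2)])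
    fix i assume "i \<in> I"
    then show "integrable M (\<lambda>\<omega>. exp_neg (T i \<omega>) ^ e i)"
      using measurable_compose[OF T[of i] measurable_exp_neg]
      by (intro integrable_const_bound[where B=1]) (auto simp: power_le_one)
  qed
  also have "\<dots> = (\<Prod>i\<in>I. laplace (distr M borel (T i)) (e i))"
    by (intro prod.cong refl) (simp add: laplace_def integral_distr T)
  finally show ?thesis .
qed

text \<open>The arrival of index \<open>k + 1\<close> has occurred by time \<open>t\<close> exactly
  when the level at \<open>t\<close> exceeds \<open>k\<close>. Hence the one-dimensional Poisson
  laws give the distribution function, and it is that of an Erlang law.\<close>

lemma distr_arrival_time_if_HPP:
  assumes HPP: "HPP M \<theta> (renewal_process T)" and "0 < \<theta>" and T: "\<And>i. 1 \<le> i \<Longrightarrow> T i \<in> borel_measurable M"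
  shows "distr M borel (arrival_time T (Suc k)) = erlang_law k \<theta>"
proof -
  let ?N = "renewal_process T" and ?S = "arrival_time T (Suc k)"
  have [measurable]: "?N t \<in> measurable M (count_space UNIV)" for t
    using T by (rule measurable_renewal_process)
  have S [measurable]: "?S \<in> borel_measurable M"
    unfolding arrival_time_def[abs_def] using T by (intro borel_measurable_sum) auto
  have N_eq: "prob {\<omega>\<in>space M. ?N t \<omega> = enat j} = poisson_mass (\<theta> * t) j" if "0 \<le> t" for t j
  proof -
    have inc: "increment ?N 0 t \<in> measurable M (count_space UNIV)"
      by (rule measurable_increment) simp_all
    have "AE \<omega> in M. ?N 0 \<omega> = 0" using HPP by (simp add: HPP_def)
    then have "AE \<omega> in M. \<omega> \<in> {\<omega>\<in>space M. ?N t \<omega> = enat j} \<longleftrightarrow> \<omega> \<in> increment ?N 0 t -` {enat j} \<inter> space M"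
      by (auto simp: increment_if_start_0 elim!: eventually_mono)
    then have "emeasure M {\<omega>\<in>space M. ?N t \<omega> = enat j} = emeasure M (increment ?N 0 t -` {enat j} \<inter> space M)"
      using inc by (intro emeasure_eq_AE) auto
    also have "\<dots> = emeasure (distr M (count_space UNIV) (increment ?N 0 t)) {enat j}"
      using inc by (simp add: emeasure_distr)
    also have "distr M (count_space UNIV) (increment ?N 0 t) = distr (Pois (\<theta> * (t - 0))) (count_space UNIV) enat"
      using HPP that unfolding HPP_def by blast
    also have "emeasure \<dots> {enat j} = ennreal (poisson_mass (\<theta> * t) j)"
      by (simp add: emeasure_distr_Pois)
    finally show ?thesis
      using \<open>0 < \<theta>\<close> that by (simp add: measure_def)
  qed
  have S_le: "prob {\<omega>\<in>space M. ?S \<omega> \<le> ennreal t} = erlang_CDF k \<theta> t" if "0 \<le> t" for t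
  proof -
    have "{\<omega>\<in>space M. ?S \<omega> \<le> ennreal t} = space M - (\<Union>j\<in>{..k}. {\<omega>\<in>space M. ?N t \<omega> = enat j})"
    proof -
      have *: "?S \<omega> \<le> ennreal t \<longleftrightarrow> \<not> (\<exists>j\<le>k. ?N t \<omega> = enat j)" for \<omega>
        unfolding enat_le_renewal_process_iff[symmetric]
        by (cases "?N t \<omega>") (auto simp: not_less_eq_eq[symmetric])
      show ?thesis unfolding * by auto
    qed
    then have "prob {\<omega>\<in>space M. ?S \<omega> \<le> ennreal t} = 1 - prob (\<Union>j\<in>{..k}. {\<omega>\<in>space M. ?N t \<omega> = enat j})"
      by (simp add: prob_compl)
    also have "prob (\<Union>j\<in>{..k}. {\<omega>\<in>space M. ?N t \<omega> = enat j}) = (\<Sum>j\<le>k. poisson_mass (\<theta> * t) j)"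
      by (subst finite_measure_finite_Union) (auto simp: disjoint_family_on_def N_eq that)
    finally show ?thesis
      using that by (simp add: erlang_CDF_def poisson_mass_def)
  qed
  interpret D: real_distribution "density lborel (erlang_density k \<theta>)"
    using \<open>0 < \<theta>\<close> by (simp add: real_distribution_def real_distribution_axioms_def prob_space_erlang_density)
  \<comment> \<open>The distribution function tends to 1, so there is no mass at infinity and the
    passage through \<open>enn2real\<close> below loses nothing.\<close>
  have "AE \<omega> in M. ?S \<omega> \<noteq> \<infinity>"
  proof -
    have "cdf (density lborel (erlang_density k \<theta>)) = erlang_CDF k \<theta>"
      using \<open>0 < \<theta>\<close> by (intro ext) (simp add: cdf_def measure_def emeasure_erlang_density)
    then have lim: "(erlang_CDF k \<theta> \<longlongrightarrow> 1) at_top"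
      using D.cdf_lim_at_top_prob by simp
    have "1 \<le> prob {\<omega>\<in>space M. ?S \<omega> \<noteq> \<infinity>}"
    proof (rule tendsto_upperbound[OF lim])
      show "\<forall>\<^sub>F t in at_top. erlang_CDF k \<theta> t \<le> prob {\<omega>\<in>space M. ?S \<omega> \<noteq> \<infinity>}"
        using eventually_ge_at_top[of 0]
      proof eventually_elim
        case (elim t)
        show ?case unfolding S_le[OF elim, symmetric]
          by (intro finite_measure_mono) (auto simp: top_unique)
      qed
    qed simp
    then have "prob {\<omega>\<in>space M. ?S \<omega> \<noteq> \<infinity>} = 1" using prob_le_1 by (intro antisym) auto
    then show ?thesis by (subst (asm) prob_Collect_eq_1) auto
  qed
  then have fin: "AE \<omega> in M. ?S \<omega> = ennreal (enn2real (?S \<omega>))"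
    by eventually_elim (simp add: less_top[symmetric])
  have "distributed M lborel (\<lambda>\<omega>. enn2real (?S \<omega>)) (erlang_density k \<theta>)"
  proof (rule erlang_distributedI)
    fix t :: real assume t: "0 \<le> t"
    have "emeasure M {\<omega>\<in>space M. enn2real (?S \<omega>) \<le> t} = emeasure M {\<omega>\<in>space M. ?S \<omega> \<le> ennreal t}"
    proof (rule emeasure_eq_AE)
      show "AE \<omega> in M. \<omega> \<in> {\<omega>\<in>space M. enn2real (?S \<omega>) \<le> t} \<longleftrightarrow> \<omega> \<in> {\<omega>\<in>space M. ?S \<omega> \<le> ennreal t}"
        using fin
      proof eventually_elim
        case (elim \<omega>)
        have "enn2real (?S \<omega>) \<le> t \<longleftrightarrow> ?S \<omega> \<le> ennreal t"
          by (subst (2) elim) (simp add: ennreal_le_iff t)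
        then show ?case by simp
      qed
    qed simp_all
    then show "emeasure M {\<omega>\<in>space M. enn2real (?S \<omega>) \<le> t} = ennreal (erlang_CDF k \<theta> t)"
      by (simp add: emeasure_eq_measure S_le t)
  qed (use \<open>0 < \<theta>\<close> in simp_all)
  then have dens: "distr M lborel (\<lambda>\<omega>. enn2real (?S \<omega>)) = density lborel (erlang_density k \<theta>)"
    by (rule distributed_distr_eq_density)
  have "distr M borel ?S = distr M borel (\<lambda>\<omega>. ennreal (enn2real (?S \<omega>)))"
    using fin by (intro distr_cong_AE) auto
  also have "\<dots> = distr (distr M lborel (\<lambda>\<omega>. enn2real (?S \<omega>))) borel ennreal"
    by (subst distr_distr) (auto simp: comp_def)
  finally show ?thesis by (simp add: dens erlang_law_def)
qed

text \<open>By independence the transform of the second arrival time is the product of those of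
  \<open>T 1\<close> and \<open>T 2\<close>; dividing by the first factor leaves the second.\<close>

lemma laplace_if_HPP:
  assumes HPP: "HPP M \<theta> (renewal_process T)" and "0 < \<theta>" and indep: "indep_vars (\<lambda>_. borel) T {1..}"
  shows "laplace (distr M borel (T 1)) n = \<theta> / (\<theta> + real n)"
    and "laplace (distr M borel (T 2)) n = \<theta> / (\<theta> + real n)"
proof -
  have T: "T i \<in> borel_measurable M" if "1 \<le> i" for i
    using indep that by (simp add: indep_vars_def)
  have S: "arrival_time T k \<in> borel_measurable M" for k
    unfolding arrival_time_def[abs_def] using T by (intro borel_measurable_sum) auto
  have law: "laplace (distr M borel (arrival_time T (Suc k))) n = (\<theta> / (\<theta> + real n)) ^ Suc k" for k
    using distr_arrival_time_if_HPP[OF HPP \<open>0 < \<theta>\<close> T] laplace_erlang_law[OF \<open>0 < \<theta>\<close>] by simp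
  have arr: "laplace (distr M borel (arrival_time T k)) n = (\<Prod>i\<in>{1..k}. laplace (distr M borel (T i)) n)" for k
  proof -
    have "laplace (distr M borel (arrival_time T k)) n = expectation (\<lambda>\<omega>. \<Prod>i\<in>{1..k}. exp_neg (T i \<omega>) ^ n)"
      unfolding laplace_def
      by (subst integral_distr[OF S]) (simp_all add: arrival_time_def exp_neg_sum prod_power_distrib)
    also have "\<dots> = (\<Prod>i\<in>{1..k}. laplace (distr M borel (T i)) n)"
      by (rule expectation_prod_exp_neg[OF indep]) auto
    finally show ?thesis .
  qed
  show 1: "laplace (distr M borel (T 1)) n = \<theta> / (\<theta> + real n)"
    using law[of 0] arr[of 1] by simp
  have "{1..2::nat} = {1, 2}" by auto
  then have "laplace (distr M borel (T 1)) n * laplace (distr M borel (T 2)) n = (\<theta> / (\<theta> + real n)) ^ 2"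
    using law[of 1] arr[of 2] by (simp add: numeral_2_eq_2)
  then show "laplace (distr M borel (T 2)) n = \<theta> / (\<theta> + real n)"
    unfolding 1 power2_eq_square using \<open>0 < \<theta>\<close> by (subst (asm) mult_left_cancel) auto
qed

text \<open>The transforms identify the laws of \<open>T 1\<close> and \<open>T 2\<close> as
  exponential with the same rate, and \<open>same_law\<close> covers the other gaps.\<close>

lemma HPP_iff_laplace:
  assumes indep: "indep_vars (\<lambda>_. borel) T {1..}"
    and same_law: "\<And>j. 2 \<le> j \<Longrightarrow> distr M borel (T j) = distr M borel (T 2)"
  shows "(\<exists>\<theta>>0. HPP M \<theta> (renewal_process T)) \<longleftrightarrow>
    (\<exists>\<theta>>0. \<forall>n. laplace (distr M borel (T 2)) n = \<theta> / (\<theta> + real n) \<and>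
      laplace (distr M borel (T 1)) n = \<theta> / (\<theta> + real n))"
proof safe
  fix \<theta> :: real assume \<theta>: "0 < \<theta>"
  assume L: "\<forall>n. laplace (distr M borel (T 2)) n = \<theta> / (\<theta> + real n) \<and>
      laplace (distr M borel (T 1)) n = \<theta> / (\<theta> + real n)"
  have T: "T i \<in> borel_measurable M" if "1 \<le> i" for i
    using indep that by (simp add: indep_vars_def)
  have law: "distr M borel (T i) = exponential_law \<theta>" if "i = 1 \<or> i = 2" for i
  proof (rule ennreal_measure_eq_if_moments_eq)
    show "prob_space (distr M borel (T i))"
      using that by (intro prob_space_distr T) auto
    show "(\<integral>x. exp_neg x ^ n \<partial>distr M borel (T i)) = (\<integral>x. exp_neg x ^ n \<partial>exponential_law \<theta>)" for n
      using that L laplace_erlang_law[OF \<theta>, of 0] by (auto simp: laplace_def)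
  qed (simp_all add: prob_space_erlang_law \<theta>)
  have "distr M borel (T i) = exponential_law \<theta>" if "1 \<le> i" for i
    using that law same_law[of i] by (cases "i = 1") auto
  then interpret exponential_renewal M \<theta> T
    by unfold_locales (use \<theta> indep in auto)
  show "\<exists>\<theta>>0. HPP M \<theta> (renewal_process T)" using HPP_renewal_process \<theta> by blast
qed (use laplace_if_HPP[OF _ _ indep] in blast)

end

subsection \<open>The joint law of the first coloured arrivals\<close>

text \<open>Functions of independent elements generate smaller algebras, hence stay independent.
  This carries the independence of the gap and colour sequences, which differ in type, over to real
  functionals, whose expectations multiply.\<close>

lemma (in prob_space) indep_var_if_indep_elements:
  assumes indep: "indep_elements M A f B g"
    and \<phi>: "\<phi> \<in> measurable A C" and \<psi>: "\<psi> \<in> measurable B C'"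
  shows "indep_var C (\<lambda>\<omega>. \<phi> (f \<omega>)) C' (\<lambda>\<omega>. \<psi> (g \<omega>))"
  unfolding indep_var_eq
proof (intro conjI)
  have f: "f \<in> measurable M A" and g: "g \<in> measurable M B"
    and ind: "indep_set (sets (vimage_algebra (space M) f A)) (sets (vimage_algebra (space M) g B))"
    using indep by (auto simp: indep_elements_def)
  show "random_variable C (\<lambda>\<omega>. \<phi> (f \<omega>))" "random_variable C' (\<lambda>\<omega>. \<psi> (g \<omega>))"
    using measurable_compose[OF f \<phi>] measurable_compose[OF g \<psi>] .
  have sub: "sigma_sets (space M) {(\<lambda>\<omega>. h (k \<omega>)) -` S \<inter> space M |S. S \<in> sets E'} \<subseteq>
      sets (vimage_algebra (space M) k E)"
    if h: "h \<in> measurable E E'" and k: "k \<in> measurable M E" for h :: "'x \<Rightarrow> 'y" and k E E'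
  proof -
    have "k \<in> measurable (vimage_algebra (space M) k E) E"
      using measurable_space[OF k] by (intro measurable_vimage_algebra1) auto
    then have hk: "(\<lambda>\<omega>. h (k \<omega>)) \<in> measurable (vimage_algebra (space M) k E) E'"
      using h by (rule measurable_compose)
    have "{(\<lambda>\<omega>. h (k \<omega>)) -` S \<inter> space M |S. S \<in> sets E'} \<subseteq> sets (vimage_algebra (space M) k E)"
      using measurable_sets[OF hk] by auto
    from sets.sigma_sets_subset[OF this] show ?thesis by simp
  qed
  show "indep_set (sigma_sets (space M) {(\<lambda>\<omega>. \<phi> (f \<omega>)) -` S \<inter> space M |S. S \<in> sets C})
      (sigma_sets (space M) {(\<lambda>\<omega>. \<psi> (g \<omega>)) -` S \<inter> space M |S. S \<in> sets C'})"
    unfolding indep_set_def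
  proof (rule indep_sets_mono_sets[OF ind[unfolded indep_set_def]])
    fix i
    show "(case i of True \<Rightarrow> sigma_sets (space M) {(\<lambda>\<omega>. \<phi> (f \<omega>)) -` S \<inter> space M |S. S \<in> sets C}
        | False \<Rightarrow> sigma_sets (space M) {(\<lambda>\<omega>. \<psi> (g \<omega>)) -` S \<inter> space M |S. S \<in> sets C'}) \<subseteq>
      (case i of True \<Rightarrow> sets (vimage_algebra (space M) f A) | False \<Rightarrow> sets (vimage_algebra (space M) g B))"
      using sub[OF \<phi> f] sub[OF \<psi> g] by (cases i) simp_all
  qed
qed

locale coloured_renewal = prob_space M for M :: "'a measure" +
  fixes p :: real and T :: "nat \<Rightarrow> 'a \<Rightarrow> ennreal" and X :: "nat \<Rightarrow> 'a \<Rightarrow> nat"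
  assumes p_pos: "0 < p" and p_less_1: "p < 1"
    and T_indep: "indep_vars (\<lambda>_. borel) T {1..}"
    and T_law: "\<forall>j\<ge>2. distr M borel (T j) = distr M borel (T 2)"
    and X_indep: "indep_vars (\<lambda>_. count_space {0, 1}) X {1..}"
    and X_law: "\<forall>i\<ge>1. distr M (count_space {0, 1}) (X i) = distr M (count_space {0, 1}) (X 1)"
    and X_1: "measure M {\<omega>\<in>space M. X 1 \<omega> = 1} = p"
    and X_0: "measure M {\<omega>\<in>space M. X 1 \<omega> = 0} = 1 - p"
    and T_X_indep: "indep_elements M
           (Pi\<^sub>M {1..} (\<lambda>_. borel)) (\<lambda>\<omega>. \<lambda>i\<in>{1..}. T i \<omega>)
           (Pi\<^sub>M {1..} (\<lambda>_. count_space {0, 1})) (\<lambda>\<omega>. \<lambda>i\<in>{1..}. X i \<omega>)"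
begin

abbreviation "f \<equiv> laplace (distr M borel (T 2))"
abbreviation "g \<equiv> laplace (distr M borel (T 1))"
abbreviation "R \<equiv> first_split_arrival T X"

definition weight :: "nat \<Rightarrow> real" where "weight c = (if c = 1 then p else 1 - p)"

lemma weight: "0 < weight c" "weight c < 1"
  using p_pos p_less_1 by (auto simp: weight_def)

lemma T_measurable: "1 \<le> i \<Longrightarrow> T i \<in> borel_measurable M"
  using T_indep by (simp add: indep_vars_def)

lemma X_measurable: "1 \<le> i \<Longrightarrow> X i \<in> measurable M (count_space {0, 1})"
  using X_indep by (simp add: indep_vars_def)

lemma X_cases: "1 \<le> i \<Longrightarrow> \<omega> \<in> space M \<Longrightarrow> X i \<omega> = 0 \<or> X i \<omega> = 1"
  using measurable_space[OF X_measurable] by fastforce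

lemma X_eq_sets: "1 \<le> i \<Longrightarrow> {\<omega>\<in>space M. X i \<omega> = c} \<in> sets M"
proof -
  assume i: "1 \<le> i"
  have "{\<omega>\<in>space M. X i \<omega> = c} = X i -` ({c} \<inter> {0, 1}) \<inter> space M"
    using X_cases[OF i] by auto
  then show ?thesis using measurable_sets[OF X_measurable[OF i], of "{c} \<inter> {0, 1}"] by simp
qed

lemma prob_X_eq:
  assumes "1 \<le> i" "c = 0 \<or> c = 1"
  shows "prob {\<omega>\<in>space M. X i \<omega> = c} = weight c"
proof -
  have *: "prob {\<omega>\<in>space M. X j \<omega> = c} = measure (distr M (count_space {0, 1}) (X j)) {c}" if "1 \<le> j" for j
  proof -
    have "X j -` {c} \<inter> space M = {\<omega>\<in>space M. X j \<omega> = c}" by auto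
    then show ?thesis
      using measure_distr[OF X_measurable[OF that], of "{c}"] assms(2) by auto
  qed
  have "prob {\<omega>\<in>space M. X i \<omega> = c} = prob {\<omega>\<in>space M. X 1 \<omega> = c}"
    unfolding *[OF assms(1)] *[OF order_refl] X_law[rule_format, OF assms(1)] ..
  then show ?thesis using assms(2) X_0 X_1 by (auto simp: weight_def)
qed

lemma expectation_prod_X:
  assumes "finite I" "I \<subseteq> {1..}" "\<And>i. i \<in> I \<Longrightarrow> col i = 0 \<or> col i = 1"
  shows "expectation (\<lambda>\<omega>. \<Prod>i\<in>I. indicat_real {col i} (X i \<omega>)) = (\<Prod>i\<in>I. weight (col i))"
proof -
  have "indep_vars (\<lambda>_. borel) (\<lambda>i \<omega>. indicat_real {col i} (X i \<omega>)) I"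
    by (rule indep_vars_compose2[OF indep_vars_subset[OF X_indep assms(2)]]) simp
  then have "expectation (\<lambda>\<omega>. \<Prod>i\<in>I. indicat_real {col i} (X i \<omega>)) = (\<Prod>i\<in>I. expectation (\<lambda>\<omega>. indicat_real {col i} (X i \<omega>)))"
  proof (rule indep_vars_lebesgue_integral[OF assms(1)])
    fix i assume "i \<in> I"
    then have "X i \<in> measurable M (count_space {0, 1})" using assms X_measurable by auto
    then have "(\<lambda>\<omega>. indicat_real {col i} (X i \<omega>)) \<in> borel_measurable M"
      by (rule measurable_compose) simp
    then show "integrable M (\<lambda>\<omega>. indicat_real {col i} (X i \<omega>))"
      by (rule integrable_const_bound[where B=1, rotated]) (simp add: indicator_def)
  qed
  also have "\<dots> = (\<Prod>i\<in>I. weight (col i))"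
  proof (intro prod.cong refl)
    fix i assume i: "i \<in> I"
    then have "1 \<le> i" using assms by auto
    have "expectation (\<lambda>\<omega>. indicat_real {col i} (X i \<omega>)) = expectation (indicat_real {\<omega>\<in>space M. X i \<omega> = col i})"
      by (intro Bochner_Integration.integral_cong) (auto split: split_indicator)
    also have "\<dots> = prob {\<omega>\<in>space M. X i \<omega> = col i}"
      by (subst Bochner_Integration.integral_indicator) (auto intro!: arg_cong[where f=prob])
    finally show "expectation (\<lambda>\<omega>. indicat_real {col i} (X i \<omega>)) = weight (col i)"
      using prob_X_eq[OF \<open>1 \<le> i\<close>] assms(3)[OF i] by simp
  qed
  finally show ?thesis .
qed

text \<open>The first \<open>m\<close> arrivals all have the other colour with probability
  \<open>weight (1 - c) ^ m\<close>, which tends to 0. On the values 0 and 1 the natural subtraction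
  \<open>1 - c\<close> swaps the colours.\<close>

lemma AE_colour_occurs:
  assumes "c = 0 \<or> c = 1"
  shows "AE \<omega> in M. \<exists>i\<ge>1. X i \<omega> = c"
proof -
  let ?c' = "1 - c"
  define B where "B = {\<omega>\<in>space M. \<forall>i\<ge>1. X i \<omega> = ?c'}"
  have B [measurable]: "B \<in> sets M"
  proof -
    have "B = (\<Inter>i\<in>{1..}. {\<omega>\<in>space M. X i \<omega> = ?c'})" by (auto simp: B_def)
    then show ?thesis using X_eq_sets by (auto intro!: sets.countable_INT')
  qed
  have "prob B \<le> weight ?c' ^ m" for m
  proof -
    have int: "integrable M (\<lambda>\<omega>. \<Prod>i\<in>{1..m}. indicat_real {?c'} (X i \<omega>))"
    proof (rule integrable_const_bound[where B=1])
      show "(\<lambda>\<omega>. \<Prod>i\<in>{1..m}. indicat_real {?c'} (X i \<omega>)) \<in> borel_measurable M"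
      proof (rule borel_measurable_prod)
        fix i assume "i \<in> {1..m}"
        then have "1 \<le> i" by simp
        from X_measurable[OF this] show "(\<lambda>\<omega>. indicat_real {?c'} (X i \<omega>)) \<in> borel_measurable M"
          by (rule measurable_compose) simp
      qed
    qed (auto simp: abs_prod intro!: prod_le_1)
    have "prob B = expectation (indicat_real B)"
      by (simp add: sets.Int_space_eq2[OF B])
    also have "\<dots> \<le> expectation (\<lambda>\<omega>. \<Prod>i\<in>{1..m}. indicat_real {?c'} (X i \<omega>))"
    proof (rule integral_mono[OF _ int])
      show "integrable M (indicat_real B)"
        using B by (rule integrable_real_indicator) (simp add: emeasure_eq_measure)
      fix \<omega>
      show "indicat_real B \<omega> \<le> (\<Prod>i\<in>{1..m}. indicat_real {?c'} (X i \<omega>))"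
      proof (cases "\<omega> \<in> B")
        case True
        then have "(\<Prod>i\<in>{1..m}. indicat_real {?c'} (X i \<omega>)) = 1"
          by (intro prod.neutral) (simp add: B_def)
        then show ?thesis by (simp add: indicator_def)
      next
        case False
        have "0 \<le> (\<Prod>i\<in>{1..m}. indicat_real {?c'} (X i \<omega>))"
          by (rule prod_nonneg) simp
        then show ?thesis using False by simp
      qed
    qed
    also have "\<dots> = weight ?c' ^ m"
      using assms by (subst expectation_prod_X) auto
    finally show ?thesis .
  qed
  moreover have "(\<lambda>m. weight ?c' ^ m) \<longlonglongrightarrow> 0"
    using weight[of ?c'] by (intro LIMSEQ_power_zero) auto
  ultimately have "prob B \<le> 0" by (intro LIMSEQ_le_const) auto
  then have "prob B = 0" using measure_nonneg[of M B] by linarith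
  then have "AE \<omega> in M. \<omega> \<notin> B" by (subst (asm) prob_eq_0) auto
  then show ?thesis
    using AE_space
  proof eventually_elim
    case (elim \<omega>)
    then obtain i where i: "1 \<le> i" "X i \<omega> \<noteq> ?c'" by (auto simp: B_def)
    then have "X i \<omega> = c" using X_cases[of i \<omega>] elim assms by auto
    then show ?case using i by blast
  qed
qed

text \<open>A run of \<open>n + 1\<close> arrivals of colour \<open>c\<close>, ended by the other
  colour at index \<open>n + 2\<close>. Almost surely exactly one pair of \<open>n\<close> and
  \<open>c\<close> fits, which gives the case split for the joint law.\<close>

definition pattern :: "nat \<Rightarrow> nat \<Rightarrow> nat \<Rightarrow> nat" where
  "pattern n c i = (if i < n + 2 then c else 1 - c)"

definition has_pattern :: "nat \<Rightarrow> nat \<Rightarrow> 'a \<Rightarrow> bool" where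
  "has_pattern n c \<omega> \<longleftrightarrow> (\<forall>i\<in>{1..n+2}. X i \<omega> = pattern n c i)"

lemma has_pattern_unique:
  assumes "has_pattern n c \<omega>" "has_pattern m c' \<omega>" "c = 0 \<or> c = 1"
  shows "n = m \<and> c = c'"
proof -
  have c: "X 1 \<omega> = c" "X 1 \<omega> = c'" using assms by (auto simp: has_pattern_def pattern_def dest!: bspec[of _ _ 1])
  have *: "\<not> a < b" if "has_pattern a c \<omega>" "has_pattern b c \<omega>" for a b
  proof
    assume "a < b"
    then have "a + 2 \<in> {1..b + 2}" by simp
    then have "X (a + 2) \<omega> = pattern b c (a + 2)"
      using that(2) unfolding has_pattern_def by blast
    moreover have "X (a + 2) \<omega> = pattern a c (a + 2)"
      using that(1) unfolding has_pattern_def by simp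
    ultimately show False using assms(3) \<open>a < b\<close> by (auto simp: pattern_def)
  qed
  then have "n = m" using assms c by (metis linorder_neqE_nat)
  then show ?thesis using c by simp
qed

lemma has_pattern_exists:
  assumes "\<omega> \<in> space M" "\<exists>i\<ge>1. X i \<omega> = 0" "\<exists>i\<ge>1. X i \<omega> = 1"
  obtains n c where "has_pattern n c \<omega>" "c = 0 \<or> c = 1"
proof -
  define c where "c = X 1 \<omega>"
  have c: "c = 0 \<or> c = 1" unfolding c_def using X_cases[of 1 \<omega>] assms by simp
  have ex: "\<exists>i\<ge>1. X i \<omega> = 1 - c" using assms c by auto
  define j where "j = (LEAST i. 1 \<le> i \<and> X i \<omega> = 1 - c)"
  have j: "1 \<le> j" "X j \<omega> = 1 - c"
    using LeastI_ex[OF ex[unfolded Bex_def]] by (auto simp: j_def)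
  have before: "X i \<omega> = c" if "1 \<le> i" "i < j" for i
    using not_less_Least[of i "\<lambda>i. 1 \<le> i \<and> X i \<omega> = 1 - c"] X_cases[of i \<omega>] that assms c
    by (auto simp: j_def)
  have "j \<noteq> 1" using j c by (auto simp: c_def)
  then obtain k where k: "j = k + 2" using j(1) by (metis add.commute le_Suc_ex le_antisym not_less_eq_eq numeral_2_eq_2 One_nat_def)
  then have "has_pattern k c \<omega>"
    using j(2) before by (auto simp: has_pattern_def pattern_def less_Suc_eq_le le_Suc_eq)
  then show ?thesis using c that by blast
qed

lemma R_if_has_pattern:
  assumes "has_pattern n c \<omega>" "c = 0 \<or> c = 1"
  shows "R c \<omega> = T 1 \<omega>" "R (1 - c) \<omega> = arrival_time T (n + 2) \<omega>"
proof -
  show "R c \<omega> = T 1 \<omega>"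
    using assms by (subst first_split_arrival_eq[where n=0]) (auto simp: has_pattern_def pattern_def arrival_time_Suc)
  have "R (1 - c) \<omega> = arrival_time T (Suc (n + 1)) \<omega>"
    using assms by (intro first_split_arrival_eq) (auto simp: has_pattern_def pattern_def)
  then show "R (1 - c) \<omega> = arrival_time T (n + 2) \<omega>" by simp
qed

text \<open>The independence of gaps and colours separates the two factors. \<open>T 1\<close>
  occurs alone and inside the arrival time, so it carries the exponent \<open>a + b\<close>; each of
  the other \<open>n + 1\<close> gaps carries \<open>a\<close>.\<close>

lemma expectation_pattern:
  assumes "c = 0 \<or> c = 1"
  shows "expectation (\<lambda>\<omega>. of_bool (has_pattern n c \<omega>) * (exp_neg (arrival_time T (n + 2) \<omega>) ^ a * exp_neg (T 1 \<omega>) ^ b)) =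
      weight c ^ (n + 1) * weight (1 - c) * (g (a + b) * f a ^ (n + 1))"
    and "integrable M (\<lambda>\<omega>. of_bool (has_pattern n c \<omega>) * (exp_neg (arrival_time T (n + 2) \<omega>) ^ a * exp_neg (T 1 \<omega>) ^ b))"
proof -
  let ?e = "\<lambda>i. if i = 1 then a + b else a"
  let ?I = "{1..n + 2}"
  let ?\<phi> = "\<lambda>\<tau> :: nat \<Rightarrow> ennreal. \<Prod>i\<in>?I. exp_neg (\<tau> i) ^ ?e i"
  let ?\<psi> = "\<lambda>\<xi> :: nat \<Rightarrow> nat. \<Prod>i\<in>?I. indicat_real {pattern n c i} (\<xi> i)"
  let ?T = "\<lambda>\<omega>. \<lambda>i\<in>{1..}. T i \<omega>" and ?X = "\<lambda>\<omega>. \<lambda>i\<in>{1..}. X i \<omega>"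
  have I: "?I = insert 1 (insert (n + 2) {2..n + 1})" by auto
  have I': "?I = insert 1 {2..n + 2}" by auto
  have \<phi>_T: "?\<phi> (?T \<omega>) = exp_neg (arrival_time T (n + 2) \<omega>) ^ a * exp_neg (T 1 \<omega>) ^ b" for \<omega>
  proof -
    have "?\<phi> (?T \<omega>) = (\<Prod>i\<in>?I. exp_neg (T i \<omega>) ^ a * (if i = 1 then exp_neg (T 1 \<omega>) ^ b else 1))"
      by (intro prod.cong) (auto simp: power_add)
    also have "\<dots> = (\<Prod>i\<in>?I. exp_neg (T i \<omega>)) ^ a * exp_neg (T 1 \<omega>) ^ b"
      unfolding prod.distrib prod_power_distrib by (subst prod.delta) auto
    finally show ?thesis unfolding arrival_time_def exp_neg_sum .
  qed
  have \<psi>_X: "?\<psi> (?X \<omega>) = of_bool (has_pattern n c \<omega>)" for \<omega>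
  proof (cases "has_pattern n c \<omega>")
    case True
    then have "?\<psi> (?X \<omega>) = 1"
      by (intro prod.neutral) (simp add: has_pattern_def)
    then show ?thesis using True by simp
  next
    case False
    then obtain i where "i \<in> ?I" "X i \<omega> \<noteq> pattern n c i" by (auto simp: has_pattern_def)
    then have "?\<psi> (?X \<omega>) = 0"
      by (intro prod_zero bexI[of _ i]) auto
    then show ?thesis using False by simp
  qed
  have \<phi>: "?\<phi> \<in> borel_measurable (Pi\<^sub>M {1..} (\<lambda>_. borel))"
  proof (intro borel_measurable_prod borel_measurable_power)
    fix i assume "i \<in> ?I"
    then have "i \<in> {1..}" by simp
    from measurable_component_singleton[OF this, of "\<lambda>_. borel"]
    show "(\<lambda>\<tau>. exp_neg (\<tau> i)) \<in> borel_measurable (Pi\<^sub>M {1..} (\<lambda>_. borel))"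
      by (rule measurable_compose) simp
  qed
  have \<psi>: "?\<psi> \<in> borel_measurable (Pi\<^sub>M {1..} (\<lambda>_. count_space {0, 1}))"
  proof (rule borel_measurable_prod)
    fix i assume "i \<in> ?I"
    then have "i \<in> {1..}" by simp
    from measurable_component_singleton[OF this, of "\<lambda>_. count_space {0, 1}"]
    show "(\<lambda>\<xi>. indicat_real {pattern n c i} (\<xi> i)) \<in> borel_measurable (Pi\<^sub>M {1..} (\<lambda>_. count_space {0, 1}))"
      by (rule measurable_compose) simp
  qed
  have ind: "indep_var borel (\<lambda>\<omega>. ?\<phi> (?T \<omega>)) borel (\<lambda>\<omega>. ?\<psi> (?X \<omega>))"
    by (rule indep_var_if_indep_elements[OF T_X_indep \<phi> \<psi>])
  have int_\<phi>: "integrable M (\<lambda>\<omega>. ?\<phi> (?T \<omega>))"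
  proof (rule integrable_const_bound[where B=1])
    show "(\<lambda>\<omega>. ?\<phi> (?T \<omega>)) \<in> borel_measurable M" by (rule indep_var_rv1[OF ind])
    show "AE \<omega> in M. norm (?\<phi> (?T \<omega>)) \<le> 1"
      unfolding \<phi>_T by (intro AE_I2) (auto intro!: mult_le_one power_le_one)
  qed
  have int_\<psi>: "integrable M (\<lambda>\<omega>. ?\<psi> (?X \<omega>))"
  proof (rule integrable_const_bound[where B=1])
    show "(\<lambda>\<omega>. ?\<psi> (?X \<omega>)) \<in> borel_measurable M" by (rule indep_var_rv2[OF ind])
    show "AE \<omega> in M. norm (?\<psi> (?X \<omega>)) \<le> 1"
      unfolding \<psi>_X by simp
  qed
  have E_\<phi>: "expectation (\<lambda>\<omega>. ?\<phi> (?T \<omega>)) = g (a + b) * f a ^ (n + 1)"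
  proof -
    have "expectation (\<lambda>\<omega>. ?\<phi> (?T \<omega>)) = expectation (\<lambda>\<omega>. \<Prod>i\<in>?I. exp_neg (T i \<omega>) ^ ?e i)"
      by (intro Bochner_Integration.integral_cong prod.cong) auto
    also have "\<dots> = (\<Prod>i\<in>?I. laplace (distr M borel (T i)) (?e i))"
      by (rule expectation_prod_exp_neg[OF T_indep]) auto
    also have "\<dots> = g (a + b) * (\<Prod>i\<in>{2..n + 2}. laplace (distr M borel (T i)) (?e i))"
      unfolding I' by (subst prod.insert) auto
    also have "(\<Prod>i\<in>{2..n + 2}. laplace (distr M borel (T i)) (?e i)) = (\<Prod>i\<in>{2..n + 2}. f a)"
    proof (intro prod.cong refl)
      fix i assume i: "i \<in> {2..n + 2}"
      then have "2 \<le> i" by simp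
      from T_law[rule_format, OF this] show "laplace (distr M borel (T i)) (?e i) = f a"
        using i by simp
    qed
    finally show ?thesis by simp
  qed
  have E_\<psi>: "expectation (\<lambda>\<omega>. ?\<psi> (?X \<omega>)) = weight c ^ (n + 1) * weight (1 - c)"
  proof -
    have "expectation (\<lambda>\<omega>. ?\<psi> (?X \<omega>)) = expectation (\<lambda>\<omega>. \<Prod>i\<in>?I. indicat_real {pattern n c i} (X i \<omega>))"
      by (intro Bochner_Integration.integral_cong prod.cong) auto
    also have "\<dots> = (\<Prod>i\<in>?I. weight (pattern n c i))"
      using assms by (intro expectation_prod_X) (auto simp: pattern_def)
    also have "\<dots> = weight (1 - c) * (\<Prod>i\<in>{1..n + 1}. weight (pattern n c i))"
      by (simp add: pattern_def)
    also have "(\<Prod>i\<in>{1..n + 1}. weight (pattern n c i)) = (\<Prod>i\<in>{1..n + 1}. weight c)"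
      by (intro prod.cong) (auto simp: pattern_def)
    finally show ?thesis by simp
  qed
  show "expectation (\<lambda>\<omega>. of_bool (has_pattern n c \<omega>) * (exp_neg (arrival_time T (n + 2) \<omega>) ^ a * exp_neg (T 1 \<omega>) ^ b)) =
      weight c ^ (n + 1) * weight (1 - c) * (g (a + b) * f a ^ (n + 1))"
    using indep_var_lebesgue_integral[OF ind int_\<phi> int_\<psi>, unfolded E_\<phi> E_\<psi>, unfolded \<phi>_T \<psi>_X]
    by (simp only: mult_ac)
  show "integrable M (\<lambda>\<omega>. of_bool (has_pattern n c \<omega>) * (exp_neg (arrival_time T (n + 2) \<omega>) ^ a * exp_neg (T 1 \<omega>) ^ b))"
    using indep_var_integrable[OF ind int_\<phi> int_\<psi>] unfolding \<phi>_T \<psi>_X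
    by (simp add: mult.commute)
qed

end

section \<open>The joint transform of the two first arrivals and its factorisation\<close>

context coloured_renewal
begin

sublocale mu: ennreal_prob "distr M borel (T 2)"
  using prob_space_distr[OF T_measurable[of 2]] by (simp add: ennreal_prob_def ennreal_prob_axioms_def)

sublocale nu: ennreal_prob "distr M borel (T 1)"
  using prob_space_distr[OF T_measurable[of 1]] by (simp add: ennreal_prob_def ennreal_prob_axioms_def)

lemma R_measurable [measurable]: "R c \<in> borel_measurable M"
proof -
  have [measurable]: "arrival_time T n \<in> borel_measurable M" for n
    unfolding arrival_time_def[abs_def] using T_measurable by (intro borel_measurable_sum) auto
  have [measurable]: "Measurable.pred M (\<lambda>\<omega>. X (Suc n) \<omega> = c)" for n
    using X_eq_sets[of "Suc n" c] by (simp add: pred_def)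
  show ?thesis
    unfolding first_split_arrival_eq_INF[abs_def] by measurable
qed

lemma moments_less_1: "0 < w \<Longrightarrow> w < 1 \<Longrightarrow> \<bar>w * f n\<bar> < 1"
proof -
  assume w: "0 < w" "w < 1"
  have "w * f n \<le> w * 1" using w mu.laplace_le_1[of n] by (intro mult_left_mono) auto
  also have "\<dots> < 1" using w by simp
  finally show ?thesis using w mu.laplace_nonneg[of n] by (simp add: abs_mult)
qed

lemma joint_moment:
  "expectation (\<lambda>\<omega>. exp_neg (R 0 \<omega>) ^ a * exp_neg (R 1 \<omega>) ^ b) =
    p * (1 - p) * (g (a + b) * (f a + f b - f a * f b)) / ((1 - p * f a) * (1 - (1 - p) * f b))"
proof -
  define Z where "Z \<omega> = exp_neg (R 0 \<omega>) ^ a * exp_neg (R 1 \<omega>) ^ b" for \<omega>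
  define h where "h n c k l \<omega> = of_bool (has_pattern n c \<omega>) *
    (exp_neg (arrival_time T (n + 2) \<omega>) ^ k * exp_neg (T 1 \<omega>) ^ l)" for n c k l \<omega>
  \<comment> \<open>If colour 1 comes first, then \<open>R 1\<close> is \<open>T 1\<close> and
    \<open>R 0\<close> is the later arrival time, so \<open>a\<close> belongs to the later one; if
    colour 0 comes first, the exponents swap. Almost surely the series of the \<open>H n\<close> has
    at most one nonzero term, and its sum is \<open>Z\<close>.\<close>
  define H where "H n \<omega> = h n 1 a b \<omega> + h n 0 b a \<omega>" for n \<omega>
  have h_nonneg: "0 \<le> h n c k l \<omega>" for n c k l \<omega> by (simp add: h_def)
  have h_eq: "h n c k l \<omega> = 0" if "\<not> has_pattern n c \<omega>" for n c k l \<omega>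
    using that by (simp add: h_def)
  have h_int: "integrable M (h n c k l)" if "c = 0 \<or> c = 1" for n c k l
    unfolding h_def[abs_def] by (rule expectation_pattern(2)[OF that])
  have H_int: "integrable M (H n)" for n
    unfolding H_def[abs_def] by (intro Bochner_Integration.integrable_add h_int) auto
  have E_H: "expectation (H n) =
      (1 - p) * g (a + b) * (p * f a * (p * f a) ^ n) + p * g (a + b) * ((1 - p) * f b * ((1 - p) * f b) ^ n)" for n
  proof -
    have "expectation (H n) = expectation (h n 1 a b) + expectation (h n 0 b a)"
      unfolding H_def[abs_def] by (intro Bochner_Integration.integral_add h_int) auto
    also have "expectation (h n 1 a b) = (1 - p) * g (a + b) * (p * f a * (p * f a) ^ n)"
      unfolding h_def[abs_def] by (subst expectation_pattern(1)) (simp_all add: weight_def power_mult_distrib)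
    also have "expectation (h n 0 b a) = p * g (a + b) * ((1 - p) * f b * ((1 - p) * f b) ^ n)"
      unfolding h_def[abs_def] by (subst expectation_pattern(1)) (simp_all add: weight_def power_mult_distrib add.commute)
    finally show ?thesis .
  qed
  define V where "V = (1 - p) * g (a + b) * (p * f a * (1 / (1 - p * f a))) +
    p * g (a + b) * ((1 - p) * f b * (1 / (1 - (1 - p) * f b)))"
  have E_sums: "(\<lambda>n. expectation (H n)) sums V"
    unfolding E_H V_def using moments_less_1 p_pos p_less_1
    by (intro sums_add sums_mult geometric_sums) auto
  have pointwise: "AE \<omega> in M. (\<lambda>n. H n \<omega>) sums Z \<omega>"
    using AE_colour_occurs[OF disjI1[OF refl]] AE_colour_occurs[OF disjI2[OF refl]] AE_space
  proof eventually_elim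
    case (elim \<omega>)
    then obtain n c where nc: "has_pattern n c \<omega>" "c = 0 \<or> c = 1"
      using has_pattern_exists[of \<omega>] by blast
    have zero: "h m c' k l \<omega> = 0" if "m \<noteq> n \<or> c' \<noteq> c" for m c' k l
      using has_pattern_unique[OF nc(1) _ nc(2), of m c'] that by (intro h_eq) blast
    have "H m \<omega> = (if m = n then Z \<omega> else 0)" for m
    proof (cases "m = n")
      case True
      show ?thesis
        using nc(2)
      proof
        assume c: "c = 0"
        have "R 0 \<omega> = T 1 \<omega>" "R 1 \<omega> = arrival_time T (n + 2) \<omega>"
          using R_if_has_pattern[OF nc] c by simp_all
        then show ?thesis
          using True zero[of n 1 a b] nc c by (simp add: H_def h_def Z_def mult.commute)
      next
        assume c: "c = 1"
        have "R 1 \<omega> = T 1 \<omega>" "R 0 \<omega> = arrival_time T (n + 2) \<omega>"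
          using R_if_has_pattern[OF nc] c by simp_all
        then show ?thesis
          using True zero[of n 0 b a] nc c by (simp add: H_def h_def Z_def)
      qed
    next
      case False
      then show ?thesis using zero[of m 1 a b] zero[of m 0 b a] by (simp add: H_def)
    qed
    then show ?case using sums_single[of n "\<lambda>_. Z \<omega>"] by simp
  qed
  have H_nonneg: "0 \<le> H n \<omega>" for n \<omega> using h_nonneg by (simp add: H_def)
  have Z_meas: "Z \<in> borel_measurable M" unfolding Z_def[abs_def] by measurable
  have "expectation Z = expectation (\<lambda>\<omega>. \<Sum>n. H n \<omega>)"
  proof (rule integral_cong_AE)
    show "AE \<omega> in M. Z \<omega> = (\<Sum>n. H n \<omega>)"
      using pointwise by eventually_elim (simp add: sums_iff)
    have "H n \<in> borel_measurable M" for n using H_int[of n] by simp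
    then show "(\<lambda>\<omega>. \<Sum>n. H n \<omega>) \<in> borel_measurable M" by (intro borel_measurable_suminf) auto
  qed (rule Z_meas)
  also have "\<dots> = (\<Sum>n. expectation (H n))"
  proof (rule integral_suminf[OF H_int])
    show "AE \<omega> in M. summable (\<lambda>n. norm (H n \<omega>))"
      using pointwise by eventually_elim (simp add: H_nonneg sums_iff)
    show "summable (\<lambda>n. expectation (\<lambda>\<omega>. norm (H n \<omega>)))"
      using E_sums by (simp add: H_nonneg sums_iff)
  qed
  also have "\<dots> = V" using E_sums by (simp add: sums_iff)
  also have "V = p * (1 - p) * (g (a + b) * (f a + f b - f a * f b)) / ((1 - p * f a) * (1 - (1 - p) * f b))"
  proof -
    have nz: "1 - p * f a \<noteq> 0" "1 - (1 - p) * f b \<noteq> 0"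
      using moments_less_1[of p a] moments_less_1[of "1 - p" b] p_pos p_less_1 by auto
    \<comment> \<open>The mixed terms \<open>f a * f b\<close> come with weights
      \<open>1 - p\<close> and \<open>p\<close>, which add up to 1; so the bracket on the right is
      free of \<open>p\<close>.\<close>
    have "(1 - p) * g (a + b) * (p * f a) * (1 - (1 - p) * f b) + p * g (a + b) * ((1 - p) * f b) * (1 - p * f a) =
        p * (1 - p) * (g (a + b) * (f a + f b - f a * f b))"
      by (simp add: algebra_simps)
    then show ?thesis
      unfolding V_def times_divide_eq_right mult_1_right add_frac_eq[OF nz] by (simp only:)
  qed
  finally show ?thesis by (simp add: Z_def[abs_def])
qed

text \<open>The marginal transforms are the joint one at \<open>b = 0\<close> and at
  \<open>a = 0\<close>, where \<open>f\<close> and \<open>g\<close> are 1 at the vanishing argument.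
  Their product has the same prefactor \<open>p * (1 - p)\<close> and the same nonzero denominators
  as the joint transform, so only the numerators are compared.\<close>

lemma moments_factor_iff:
  "expectation (\<lambda>\<omega>. exp_neg (R 0 \<omega>) ^ a * exp_neg (R 1 \<omega>) ^ b) =
      expectation (\<lambda>\<omega>. exp_neg (R 0 \<omega>) ^ a) * expectation (\<lambda>\<omega>. exp_neg (R 1 \<omega>) ^ b) \<longleftrightarrow>
    g (a + b) * (f a + f b - f a * f b) = g a * g b"
proof -
  define A B where "A = 1 - p * f a" and "B = 1 - (1 - p) * f b"
  have pos: "0 < A" "0 < B"
    using moments_less_1[of p a] moments_less_1[of "1 - p" b] p_pos p_less_1 by (auto simp: A_def B_def)
  have "expectation (\<lambda>\<omega>. exp_neg (R 0 \<omega>) ^ a) = p * (1 - p) * g a / (A * p)"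
    using joint_moment[of a 0] by (simp add: A_def)
  then have E0: "expectation (\<lambda>\<omega>. exp_neg (R 0 \<omega>) ^ a) = (1 - p) * g a / A"
    using p_pos by simp
  have "expectation (\<lambda>\<omega>. exp_neg (R 1 \<omega>) ^ b) = p * (1 - p) * g b / ((1 - p) * B)"
    using joint_moment[of 0 b] by (simp add: B_def)
  then have E1: "expectation (\<lambda>\<omega>. exp_neg (R 1 \<omega>) ^ b) = p * g b / B"
    using p_less_1 by simp
  have "p * (1 - p) * x / (A * B) = (1 - p) * y / A * (p * z / B) \<longleftrightarrow> x = y * z" for x y z
  proof -
    have "(1 - p) * y / A * (p * z / B) = p * (1 - p) * (y * z) / (A * B)"
      by (simp add: mult_ac)
    then show ?thesis using pos p_pos p_less_1 by simp
  qed
  then show ?thesis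
    unfolding joint_moment E0 E1 A_def[symmetric] B_def[symmetric] .
qed

lemma indep_iff_functional_eq:
  "indep_var borel (R 0) borel (R 1) \<longleftrightarrow>
    (\<forall>a b. g (a + b) * (f a + f b - f a * f b) = g a * g b)"
proof
  assume indep: "indep_var borel (R 0) borel (R 1)"
  show "\<forall>a b. g (a + b) * (f a + f b - f a * f b) = g a * g b"
  proof (intro allI)
    fix a b
    have int: "integrable M (\<lambda>\<omega>. exp_neg (R c \<omega>) ^ k)" for c k
      by (intro integrable_const_bound[where B=1]) (auto simp: power_le_one)
    have "indep_var borel ((\<lambda>x. exp_neg x ^ a) \<circ> R 0) borel ((\<lambda>x. exp_neg x ^ b) \<circ> R 1)"
      by (rule indep_var_compose[OF indep]) simp_all
    then have "indep_var borel (\<lambda>\<omega>. exp_neg (R 0 \<omega>) ^ a) borel (\<lambda>\<omega>. exp_neg (R 1 \<omega>) ^ b)"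
      by (simp add: comp_def)
    from indep_var_lebesgue_integral[OF this int int]
    show "g (a + b) * (f a + f b - f a * f b) = g a * g b"
      unfolding moments_factor_iff .
  qed
next
  assume "\<forall>a b. g (a + b) * (f a + f b - f a * f b) = g a * g b"
  then show "indep_var borel (R 0) borel (R 1)"
    by (intro indep_var_ennreal_if_moments_factor) (simp_all only: moments_factor_iff R_measurable)
qed

lemma exponential_functional_eq:
  assumes "0 < \<theta>" "\<And>n. f n = \<theta> / (\<theta> + real n)" "\<And>n. g n = \<theta> / (\<theta> + real n)"
  shows "g (a + b) * (f a + f b - f a * f b) = g a * g b"
proof -
  define u v where "u = \<theta> + real a" and "v = \<theta> + real b"
  have pos: "0 < u" "0 < v" "0 < \<theta> + real (a + b)" using assms(1) by (simp_all add: u_def v_def)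
  have "\<theta> / u + \<theta> / v - \<theta> / u * (\<theta> / v) = \<theta> * (u + v - \<theta>) / (u * v)"
    using pos by (simp add: field_simps)
  also have "u + v - \<theta> = \<theta> + real (a + b)" by (simp add: u_def v_def)
  finally show ?thesis
    unfolding assms(2,3) using pos by (simp add: u_def[symmetric] v_def[symmetric])
qed

section \<open>Functional equation and Poisson property\<close>

lemma HPP_iff:
  "(\<exists>\<theta>>0. HPP M \<theta> (renewal_process T)) \<longleftrightarrow>
    (\<exists>\<theta>>0. \<forall>n. f n = \<theta> / (\<theta> + real n) \<and> g n = \<theta> / (\<theta> + real n))"
  by (rule HPP_iff_laplace[OF T_indep]) (rule T_law[rule_format])

lemma indep_if_HPP: "\<exists>\<theta>>0. HPP M \<theta> (renewal_process T) \<Longrightarrow> indep_var borel (R 0) borel (R 1)"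
  unfolding indep_iff_functional_eq HPP_iff using exponential_functional_eq by blast

lemma HPP_if_functional_eq_near_0:
  assumes fe: "\<forall>a b. g (a + b) * (f a + f b - f a * f b) = g a * g b"
    and near_0: "\<forall>\<epsilon>::real. \<epsilon> > 0 \<longrightarrow> measure M {\<omega>\<in>space M. T 1 \<omega> < ennreal \<epsilon>} > 0"
    and arith: "non_arithmetic M (T 2) \<or> measure M {\<omega>\<in>space M. T 1 \<omega> = 0} = 0"
  shows "\<exists>\<theta>>0. HPP M \<theta> (renewal_process T)"
proof -
  have meas: "measure (distr M borel (T i)) B = prob {\<omega>\<in>space M. T i \<omega> \<in> B}"
    if "1 \<le> i" "B \<in> sets borel" for i B
    using that T_measurable[of i] by (simp add: measure_distr vimage_def Int_def conj_commute)
  interpret fe: functional_eq "distr M borel (T 1)" "distr M borel (T 2)"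
    by unfold_locales (use fe near_0 in \<open>auto simp: meas\<close>)
  show ?thesis
    unfolding HPP_iff
  proof (rule fe.exponential_if_not_arithmetic)
    show "\<not> (\<exists>\<alpha>>0. measure (distr M borel (T 2)) (insert \<infinity> (range (\<lambda>n::nat. ennreal (\<alpha> * real n)))) = 1) \<or>
      measure (distr M borel (T 1)) {0} = 0"
    proof -
      have "measure (distr M borel (T 1)) {0} = prob {\<omega>\<in>space M. T 1 \<omega> = 0}"
        using meas[of 1 "{0}"] by simp
      moreover have "measure (distr M borel (T 2)) (insert \<infinity> (range h)) = prob {\<omega>\<in>space M. T 2 \<omega> \<in> insert \<infinity> (range h)}"
        for h :: "nat \<Rightarrow> ennreal"
        by (rule meas) (simp, rule lattice_in_borel)
      ultimately show ?thesis
        using arith unfolding non_arithmetic_def by (simp only:)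
    qed
  qed
qed

text \<open>Here \<open>f = g\<close> from the start. Finiteness of \<open>T 1\<close> gives
  \<open>g n > 0\<close> and positivity gives \<open>g 1 < 1\<close>, the inputs of
  \<open>hyperbolic_if_functional_eq\<close>.\<close>

lemma HPP_if_functional_eq_ordinary:
  assumes fe: "\<forall>a b. g (a + b) * (f a + f b - f a * f b) = g a * g b"
    and ord: "ordinary M T"
  shows "\<exists>\<theta>>0. HPP M \<theta> (renewal_process T)"
proof -
  have T1: "T 1 \<in> borel_measurable M" by (rule T_measurable) simp
  have same: "distr M borel (T 2) = distr M borel (T 1)" using ord by (simp add: ordinary_def)
  have "prob {\<omega>\<in>space M. 0 < T 1 \<omega> \<and> T 1 \<omega> < \<infinity>} = 1"
    using ord by (simp add: ordinary_def)
  then have AE: "AE \<omega> in M. 0 < T 1 \<omega> \<and> T 1 \<omega> < \<infinity>"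
    using T1 by (subst (asm) prob_Collect_eq_1) auto
  have int: "integrable M (\<lambda>\<omega>. exp_neg (T 1 \<omega>) ^ n)" for n
    using T1 by (intro integrable_const_bound[where B=1]) (auto simp: power_le_one)
  have g_eq: "g n = expectation (\<lambda>\<omega>. exp_neg (T 1 \<omega>) ^ n)" for n
    unfolding laplace_def by (subst integral_distr[OF T1]) simp_all
  have g_pos: "0 < g n" for n
  proof -
    have "AE \<omega> in M. 0 < exp_neg (T 1 \<omega>) ^ n"
      using AE by eventually_elim (auto simp: exp_neg_def)
    then show ?thesis
      unfolding g_eq by (rule expectation_greater[OF int])
  qed
  have g_1: "g 1 < 1"
  proof -
    have "AE \<omega> in M. exp_neg (T 1 \<omega>) ^ 1 < 1"
      using AE by eventually_elim (auto simp: exp_neg_def enn2real_positive_iff)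
    then show ?thesis
      unfolding g_eq by (rule expectation_less[OF int])
  qed
  have "\<exists>\<theta>>0. \<forall>n. g n = \<theta> / (\<theta> + real n)"
  proof (rule hyperbolic_if_functional_eq[OF g_pos nu.laplace_0 g_1])
    fix a b show "g (a + b) * (g a + g b - g a * g b) = g a * g b"
      using fe unfolding same by blast
  qed
  then obtain \<theta> where "0 < \<theta>" "\<forall>n. g n = \<theta> / (\<theta> + real n)" by blast
  then have "\<exists>\<theta>>0. \<forall>n. f n = \<theta> / (\<theta> + real n) \<and> g n = \<theta> / (\<theta> + real n)"
    unfolding same by (intro exI[of _ \<theta>]) simp
  then show ?thesis
    by (rule HPP_iff[THEN iffD2])
qed

end

theorem theorem1:
  fixes M :: "'a measure" and p :: real
    and T :: "nat \<Rightarrow> 'a \<Rightarrow> ennreal" and X :: "nat \<Rightarrow> 'a \<Rightarrow> nat"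
  assumes "prob_space M"
    and "0 < p" and "p < 1"
    and "prob_space.indep_vars M (\<lambda>_. borel) T {1..}"
    and "\<forall>j\<ge>2. distr M borel (T j) = distr M borel (T 2)"
    and "prob_space.indep_vars M (\<lambda>_. count_space {0, 1}) X {1..}"
    and "\<forall>i\<ge>1. distr M (count_space {0, 1}) (X i) = distr M (count_space {0, 1}) (X 1)"
    and "measure M {\<omega>\<in>space M. X 1 \<omega> = 1} = p"
    and "measure M {\<omega>\<in>space M. X 1 \<omega> = 0} = 1 - p"
    and "indep_elements M
           (Pi\<^sub>M {1..} (\<lambda>_. borel)) (\<lambda>\<omega>. \<lambda>i\<in>{1..}. T i \<omega>)
           (Pi\<^sub>M {1..} (\<lambda>_. count_space {0, 1})) (\<lambda>\<omega>. \<lambda>i\<in>{1..}. X i \<omega>)"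
  shows "((\<forall>\<epsilon>::real. \<epsilon> > 0 \<longrightarrow> measure M {\<omega>\<in>space M. T 1 \<omega> < ennreal \<epsilon>} > 0) \<and>
          (non_arithmetic M (T 2) \<or> measure M {\<omega>\<in>space M. T 1 \<omega> = 0} = 0) \<longrightarrow>
          (prob_space.indep_var M
             borel (first_split_arrival T X 0) borel (first_split_arrival T X 1) \<longleftrightarrow>
           (\<exists>\<theta>>0. HPP M \<theta> (renewal_process T)))) \<and>
         (ordinary M T \<longrightarrow>
          (prob_space.indep_var M
             borel (first_split_arrival T X 0) borel (first_split_arrival T X 1) \<longleftrightarrow>
           (\<exists>\<theta>>0. HPP M \<theta> (renewal_process T))))"
proof -
  interpret coloured_renewal M p T X
    by (intro coloured_renewal.intro coloured_renewal_axioms.intro; fact assms)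
  have "indep_var borel (R 0) borel (R 1) \<longleftrightarrow> (\<exists>\<theta>>0. HPP M \<theta> (renewal_process T))"
    if near_0: "\<forall>\<epsilon>::real. \<epsilon> > 0 \<longrightarrow> measure M {\<omega>\<in>space M. T 1 \<omega> < ennreal \<epsilon>} > 0"
      and arith: "non_arithmetic M (T 2) \<or> measure M {\<omega>\<in>space M. T 1 \<omega> = 0} = 0"
    by (rule iffI[OF HPP_if_functional_eq_near_0[OF indep_iff_functional_eq[THEN iffD1] near_0 arith] indep_if_HPP])
  moreover have "indep_var borel (R 0) borel (R 1) \<longleftrightarrow> (\<exists>\<theta>>0. HPP M \<theta> (renewal_process T))"
    if ord: "ordinary M T"
    by (rule iffI[OF HPP_if_functional_eq_ordinary[OF indep_iff_functional_eq[THEN iffD1] ord] indep_if_HPP])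
  ultimately show ?thesis
    by (intro conjI impI) (elim conjE)
qed

end
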